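(* In the setting described in the context, assume condition $(\mathtt{A})$ holds with parameter $\delta\in\,]0,1/2[$, and set $g:=e^{\delta U}$, $h:=e^{\delta V}$. Then there exist some $a>0$ and $\varrho\in\,]0,1[$ such that, for any $n\ge 1$, $$ \mathrm{lip}_{g_a,h_a}(\mathcal{K}_{2n})\vee \mathrm{lip}_{h_a,g_a}(\mathcal{K}_{2n+1})\le \varrho \quad\text{with}\quad g_a:=\tfrac12+a\,g,\quad h_a:=\tfrac12+a\,h . $$ In addition, $$ \sup_{n\ge 1}\left(\pi_{2n}(h)\vee\pi_{2n+1}(g)\right)<\infty\quad\text{and}\quad \sup_{n\ge 1}\left(\Vert\mathcal{K}_{2n}(h)\Vert_g\vee\Vert\mathcal{K}_{2n+1}(g)\Vert_h\right)<\infty . $$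
   Context: Setting. $(\mathbb{X},\lambda)$ and $(\mathbb{Y},\nu)$ are locally compact Polish spaces with locally bounded positive measures. For a function $F$ on $\mathbb{X}$ (resp. $\mathbb{Y}$) write $\lambda_F(dx)=e^{-F(x)}\lambda(dx)$ (resp. $\nu_F(dy)=e^{-F(y)}\nu(dy)$). $\mu=\lambda_U$ and $\eta=\nu_V$ are probability measures, and $K(x,dy)=e^{-W(x,y)}\nu(dy)$ is a Markov transition from $\mathbb{X}$ to $\mathbb{Y}$. Standing assumptions: $U,V,W$ are real valued and locally bounded, $\sup e^{-W}<\infty$, and $U,V$ have compact sub-level sets. Put $W^V(x):=\int\nu_V(dy)W(x,y)$, $W_U(y):=\int\lambda_U(dx)W(x,y)$, $\mathcal{U}_\delta:=\delta U-W^V$, $\mathcal{V}_\delta:=\delta V-W_U$. $\mathcal{B}_0(\mathbb{X})$ is the set of bounded positive functions $\theta$ on $\mathbb{X}$ that are locally lower bounded (away from zero) and vanish at infinity, i.e. for any $0<\epsilon<\Vert\theta\Vert:=\sup\theta$ the set $\{\theta\ge\epsilon\}$ is non-empty and compact; likewise $\mathcal{B}_0(\mathbb{Y})$. Condition $(\mathtt{A})$: there exist $\delta\in\,]0,1/2[$ and $(\theta_u,\theta_v)\in\mathcal{B}_0(\mathbb{X})\times\mathcal{B}_0(\mathbb{Y})$ such that $\lambda_{(1-2\delta)U}(1)\vee\nu_{(1-2\delta)V}(1)<\infty$, $e^{-\mathcal{U}_\delta}\le\theta_u$ and $e^{-\mathcal{V}_\delta}\le\theta_v$. Sinkhorn transitions.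 Let $K(f)(x)=\int e^{-W(x,y)}f(y)\nu(dy)$ and $K^\flat(f)(y)=\int e^{-W(x,y)}f(x)\lambda(dx)$. Let $(U_0,V_0)=(U,0)$ and, for $n\ge0$, $U_{2n+1}=U_{2n}$, $V_{2n+1}=V+\log K^\flat(e^{-U_{2n}})$, $U_{2(n+1)}=U+\log K(e^{-V_{2n+1}})$, $V_{2(n+1)}=V_{2n+1}$. Then $$\mathcal{K}_{2n}(x,dy)=\frac{e^{-W(x,y)-V_{2n}(y)}\nu(dy)}{K(e^{-V_{2n}})(x)},\qquad \mathcal{K}_{2n+1}(y,dx)=\frac{e^{-W(x,y)-U_{2n+1}(x)}\lambda(dx)}{K^\flat(e^{-U_{2n+1}})(y)},$$ $\pi_{2n}:=\mu\mathcal{K}_{2n}$, $\pi_{2n+1}:=\eta\mathcal{K}_{2n+1}$. Norms. For a function $g>0$ bounded away from zero, $\Vert f\Vert_g:=\sup|f/g|$; for a bounded signed measure $m$, $|||m|||_g:=|m|(g)$ with $|m|$ the total variation measure; $\mathrm{Prob}_g$ is the set of probability measures $m$ with $m(g)<\infty$. For a Markov transition $L$ from one space to another and positive functions $g$ (on the source) and $h$ (on the target) bounded away from zero, $\mathrm{lip}_{g,h}(L):=\sup\frac{|||\mu_1L-\mu_2L|||_h}{|||\mu_1-\mu_2|||_g}$, supremum over $\mu_1\ne\mu_2$ in $\mathrm{Prob}_g$. $a\vee b=\max(a,b)$, and $m(f)=\int f\,dm$. *)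

theory Defs
  imports "HOL-Probability.Probability"
begin

text \<open>Locally bounded measures and functions. On a locally compact space this is the same as
  boundedness on compact sets.\<close>

definition locally_bounded_measure :: "'a::topological_space measure \<Rightarrow> bool" where
  "locally_bounded_measure M \<longleftrightarrow> (\<forall>x. \<exists>S. open S \<and> x \<in> S \<and> emeasure M S < \<infinity>)"

definition locally_bounded :: "('a::topological_space \<Rightarrow> real) \<Rightarrow> bool" where
  "locally_bounded f \<longleftrightarrow> (\<forall>x. \<exists>S. open S \<and> x \<in> S \<and> bounded (f ` S))"

definition gibbs :: "'a measure \<Rightarrow> ('a \<Rightarrow> real) \<Rightarrow> 'a measure" where
  "gibbs M F = density M (\<lambda>x. ennreal (exp (- F x)))"

text \<open>The class \<open>polish_space\<close> fixes a complete metric, but only the topology is used.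
  Measurability of \<open>U\<close>, \<open>V\<close>, \<open>W\<close> is implicit in the mathematical setting.\<close>

locale schroedinger_setting =
  fixes lam :: "'x::polish_space measure" and nu :: "'y::polish_space measure"
    and U :: "'x \<Rightarrow> real" and V :: "'y \<Rightarrow> real" and W :: "'x \<Rightarrow> 'y \<Rightarrow> real"
  assumes locally_compact_X: "locally compact (UNIV :: 'x set)"
    and locally_compact_Y: "locally compact (UNIV :: 'y set)"
    and sets_lam: "sets lam = sets borel"
    and sets_nu: "sets nu = sets borel"
    and locally_bounded_lam: "locally_bounded_measure lam"
    and locally_bounded_nu: "locally_bounded_measure nu"
    and measurable_U: "U \<in> borel_measurable borel"
    and measurable_V: "V \<in> borel_measurable borel"
    and measurable_W: "case_prod W \<in> borel_measurable (borel \<Otimes>\<^sub>M borel)"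
    and locally_bounded_U: "locally_bounded U"
    and locally_bounded_V: "locally_bounded V"
    and locally_bounded_W: "locally_bounded (case_prod W)"
    and bounded_exp_W: "\<exists>c. \<forall>x y. exp (- W x y) \<le> c"
    and compact_sublevel_U: "\<And>r. compact {x. U x \<le> r}"
    and compact_sublevel_V: "\<And>r. compact {y. V y \<le> r}"
    and prob_mu: "prob_space (gibbs lam U)"
    and prob_eta: "prob_space (gibbs nu V)"
    and markov_K: "(\<lambda>x. gibbs nu (W x)) \<in> borel \<rightarrow>\<^sub>M prob_algebra borel"

definition B0 :: "('a::topological_space \<Rightarrow> real) set" where
  "B0 = {\<theta>. (\<forall>x. 0 < \<theta> x) \<and> bdd_above (range \<theta>)
     \<and> (\<forall>x. \<exists>S c. open S \<and> x \<in> S \<and> 0 < c \<and> (\<forall>z\<in>S. c \<le> \<theta> z))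
     \<and> (\<forall>\<epsilon>. 0 < \<epsilon> \<and> \<epsilon> < (SUP x. \<theta> x) \<longrightarrow> {x. \<epsilon> \<le> \<theta> x} \<noteq> {} \<and> compact {x. \<epsilon> \<le> \<theta> x})}"

definition W_sup :: "'y measure \<Rightarrow> ('y \<Rightarrow> real) \<Rightarrow> ('x \<Rightarrow> 'y \<Rightarrow> real) \<Rightarrow> 'x \<Rightarrow> real" where
  "W_sup nu V W x = (LINT y|gibbs nu V. W x y)"

definition W_sub :: "'x measure \<Rightarrow> ('x \<Rightarrow> real) \<Rightarrow> ('x \<Rightarrow> 'y \<Rightarrow> real) \<Rightarrow> 'y \<Rightarrow> real" where
  "W_sub lam U W y = (LINT x|gibbs lam U. W x y)"

definition U_delta ::
  "'y measure \<Rightarrow> ('x \<Rightarrow> real) \<Rightarrow> ('y \<Rightarrow> real) \<Rightarrow> ('x \<Rightarrow> 'y \<Rightarrow> real) \<Rightarrow> real \<Rightarrow> 'x \<Rightarrow> real" where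
  "U_delta nu U V W \<delta> x = \<delta> * U x - W_sup nu V W x"

definition V_delta ::
  "'x measure \<Rightarrow> ('x \<Rightarrow> real) \<Rightarrow> ('y \<Rightarrow> real) \<Rightarrow> ('x \<Rightarrow> 'y \<Rightarrow> real) \<Rightarrow> real \<Rightarrow> 'y \<Rightarrow> real" where
  "V_delta lam U V W \<delta> y = \<delta> * V y - W_sub lam U W y"

text \<open>Since \<open>W\<close> is bounded below, the integrals in \<open>W_sup\<close> and \<open>W_sub\<close> are well defined in
  \<open>]-\<infinity>, \<infinity>]\<close>, and the bounds by \<open>\<theta>u\<close> and \<open>\<theta>v\<close> say in particular that they are finite.
  As the Bochner integral of a non-integrable function is 0, this finiteness is made explicit by
  the two integrability clauses.\<close>

definition condition_A :: "'x::topological_space measure \<Rightarrow> 'y::topological_space measure \<Rightarrow>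
    ('x \<Rightarrow> real) \<Rightarrow> ('y \<Rightarrow> real) \<Rightarrow> ('x \<Rightarrow> 'y \<Rightarrow> real) \<Rightarrow> real \<Rightarrow> bool" where
  "condition_A lam nu U V W \<delta> \<longleftrightarrow>
     0 < \<delta> \<and> \<delta> < 1/2
     \<and> max (emeasure (gibbs lam (\<lambda>x. (1 - 2 * \<delta>) * U x)) UNIV)
           (emeasure (gibbs nu (\<lambda>y. (1 - 2 * \<delta>) * V y)) UNIV) < \<infinity>
     \<and> (\<forall>x. integrable (gibbs nu V) (\<lambda>y. W x y))
     \<and> (\<forall>y. integrable (gibbs lam U) (\<lambda>x. W x y))
     \<and> (\<exists>\<theta>u\<in>B0. \<exists>\<theta>v\<in>B0.
           (\<forall>x. exp (- U_delta nu U V W \<delta> x) \<le> \<theta>u x)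
         \<and> (\<forall>y. exp (- V_delta lam U V W \<delta> y) \<le> \<theta>v y))"

text \<open>The operators \<open>K\<close> and its dual. They are only applied to positive functions, for which,
  in the setting above and under \<open>condition_A\<close>, the integrals are positive and finite.\<close>

definition K_op :: "'y measure \<Rightarrow> ('x \<Rightarrow> 'y \<Rightarrow> real) \<Rightarrow> ('y \<Rightarrow> real) \<Rightarrow> 'x \<Rightarrow> real" where
  "K_op nu W f x = (LINT y|nu. exp (- W x y) * f y)"

definition K_flat :: "'x measure \<Rightarrow> ('x \<Rightarrow> 'y \<Rightarrow> real) \<Rightarrow> ('x \<Rightarrow> real) \<Rightarrow> 'y \<Rightarrow> real" where
  "K_flat lam W f y = (LINT x|lam. exp (- W x y) * f x)"

primrec sinkhorn :: "'x measure \<Rightarrow> 'y measure \<Rightarrow> ('x \<Rightarrow> real) \<Rightarrow> ('y \<Rightarrow> real) \<Rightarrow>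
    ('x \<Rightarrow> 'y \<Rightarrow> real) \<Rightarrow> nat \<Rightarrow> ('x \<Rightarrow> real) \<times> ('y \<Rightarrow> real)" where
  "sinkhorn lam nu U V W 0 = (U, \<lambda>_. 0)"
| "sinkhorn lam nu U V W (Suc n) =
    (let (Uc, Vc) = sinkhorn lam nu U V W n in
     if even n then (Uc, \<lambda>y. V y + ln (K_flat lam W (\<lambda>x. exp (- Uc x)) y))
     else (\<lambda>x. U x + ln (K_op nu W (\<lambda>y. exp (- Vc y)) x), Vc))"

definition sinkhorn_U :: "'x measure \<Rightarrow> 'y measure \<Rightarrow> ('x \<Rightarrow> real) \<Rightarrow> ('y \<Rightarrow> real) \<Rightarrow>
    ('x \<Rightarrow> 'y \<Rightarrow> real) \<Rightarrow> nat \<Rightarrow> 'x \<Rightarrow> real" where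
  "sinkhorn_U lam nu U V W n = fst (sinkhorn lam nu U V W n)"

definition sinkhorn_V :: "'x measure \<Rightarrow> 'y measure \<Rightarrow> ('x \<Rightarrow> real) \<Rightarrow> ('y \<Rightarrow> real) \<Rightarrow>
    ('x \<Rightarrow> 'y \<Rightarrow> real) \<Rightarrow> nat \<Rightarrow> 'y \<Rightarrow> real" where
  "sinkhorn_V lam nu U V W n = snd (sinkhorn lam nu U V W n)"

text \<open>\<open>K_even \<dots> n\<close> and \<open>K_odd \<dots> n\<close> are the Sinkhorn transitions with index \<open>2 n\<close> and
  \<open>2 n + 1\<close>; likewise for \<open>pi_even\<close> and \<open>pi_odd\<close>.\<close>

definition K_even :: "'x measure \<Rightarrow> 'y measure \<Rightarrow> ('x \<Rightarrow> real) \<Rightarrow> ('y \<Rightarrow> real) \<Rightarrow>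
    ('x \<Rightarrow> 'y \<Rightarrow> real) \<Rightarrow> nat \<Rightarrow> 'x \<Rightarrow> 'y measure" where
  "K_even lam nu U V W n x =
    (let V2n = sinkhorn_V lam nu U V W (2 * n) in
     density nu (\<lambda>y. ennreal (exp (- W x y - V2n y) / K_op nu W (\<lambda>z. exp (- V2n z)) x)))"

definition K_odd :: "'x measure \<Rightarrow> 'y measure \<Rightarrow> ('x \<Rightarrow> real) \<Rightarrow> ('y \<Rightarrow> real) \<Rightarrow>
    ('x \<Rightarrow> 'y \<Rightarrow> real) \<Rightarrow> nat \<Rightarrow> 'y \<Rightarrow> 'x measure" where
  "K_odd lam nu U V W n y =
    (let U2n1 = sinkhorn_U lam nu U V W (2 * n + 1) in
     density lam (\<lambda>x. ennreal (exp (- W x y - U2n1 x) / K_flat lam W (\<lambda>z. exp (- U2n1 z)) y)))"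

definition pi_even :: "'x measure \<Rightarrow> 'y measure \<Rightarrow> ('x \<Rightarrow> real) \<Rightarrow> ('y \<Rightarrow> real) \<Rightarrow>
    ('x \<Rightarrow> 'y \<Rightarrow> real) \<Rightarrow> nat \<Rightarrow> 'y measure" where
  "pi_even lam nu U V W n = gibbs lam U \<bind> K_even lam nu U V W n"

definition pi_odd :: "'x measure \<Rightarrow> 'y measure \<Rightarrow> ('x \<Rightarrow> real) \<Rightarrow> ('y \<Rightarrow> real) \<Rightarrow>
    ('x \<Rightarrow> 'y \<Rightarrow> real) \<Rightarrow> nat \<Rightarrow> 'x measure" where
  "pi_odd lam nu U V W n = gibbs nu V \<bind> K_odd lam nu U V W n"

text \<open>Integrals \<open>m(f)\<close> and \<open>L(f)(x)\<close> of positive functions are taken with values in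
  \<open>[0, \<infinity>]\<close>, so that statements about their finiteness are meaningful.\<close>

definition kernel_int :: "('a \<Rightarrow> 'b measure) \<Rightarrow> ('b \<Rightarrow> real) \<Rightarrow> 'a \<Rightarrow> ennreal" where
  "kernel_int L f x = (\<integral>\<^sup>+ z. ennreal (f z) \<partial>(L x))"

definition weighted_sup_norm :: "('a \<Rightarrow> real) \<Rightarrow> ('a \<Rightarrow> ennreal) \<Rightarrow> ennreal" where
  "weighted_sup_norm g f = (SUP x. f x / ennreal (g x))"

text \<open>A bounded signed measure on \<open>M\<close> is represented by its set function \<open>m\<close>; its total
  variation measure assigns to \<open>A\<close> the supremum of \<open>\<Sum>B\<in>P. \<bar>m B\<bar>\<close> over the finite measurable
  partitions \<open>P\<close> of \<open>A\<close>.\<close>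

definition total_variation :: "'a measure \<Rightarrow> ('a set \<Rightarrow> real) \<Rightarrow> 'a measure" where
  "total_variation M m = measure_of (space M) (sets M)
     (\<lambda>A. SUP P\<in>{P. finite P \<and> partition_on A P \<and> P \<subseteq> sets M}. \<Sum>B\<in>P. ennreal \<bar>m B\<bar>)"

definition weighted_tv_norm :: "('a::topological_space \<Rightarrow> real) \<Rightarrow> ('a set \<Rightarrow> real) \<Rightarrow> ennreal" where
  "weighted_tv_norm g m = (\<integral>\<^sup>+ x. ennreal (g x) \<partial>(total_variation borel m))"

definition Prob_weighted :: "('a::topological_space \<Rightarrow> real) \<Rightarrow> 'a measure set" where
  "Prob_weighted g = {M. sets M = sets borel \<and> prob_space M \<and> (\<integral>\<^sup>+ x. ennreal (g x) \<partial>M) < \<infinity>}"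

definition lip :: "('a::topological_space \<Rightarrow> real) \<Rightarrow> ('b::topological_space \<Rightarrow> real) \<Rightarrow>
    ('a \<Rightarrow> 'b measure) \<Rightarrow> ennreal" where
  "lip g h L =
    (SUP (\<mu>1, \<mu>2)\<in>{(\<mu>1, \<mu>2). \<mu>1 \<in> Prob_weighted g \<and> \<mu>2 \<in> Prob_weighted g \<and> \<mu>1 \<noteq> \<mu>2}.
       weighted_tv_norm h (\<lambda>A. measure (\<mu>1 \<bind> L) A - measure (\<mu>2 \<bind> L) A)
       / weighted_tv_norm g (\<lambda>A. measure \<mu>1 A - measure \<mu>2 A))"

end

theory Submission
  imports Defs
begin

text \<open>Centre the Sinkhorn potentials as \<open>u = U\<^sub>2\<^sub>n - U\<close> and \<open>v = V\<^sub>2\<^sub>n - V\<close>, so that all integrals are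
  against the probability measures \<open>\<mu>\<close> and \<open>\<eta>\<close>. The means \<open>\<mu>(u)\<close> and \<open>\<eta>(v)\<close> decrease along the
  iteration (they change by relative entropies), hence are bounded above. Jensen's inequality then
  bounds \<open>e\<^sup>-\<^sup>u\<close> and \<open>e\<^sup>-\<^sup>v\<close> by multiples of \<open>exp W\<^sup>V\<close> and \<open>exp W\<^sub>U\<close>, and in turn \<open>e\<^sup>u\<close> and \<open>e\<^sup>v\<close> by
  constants, uniformly in \<open>n\<close>. So every Sinkhorn transition has a density \<open>k\<close> with
  \<open>e\<^bsup>-W(x,y)\<^esup> / D \<le> k(x,y) \<le> D exp (W\<^sup>V(x) + W\<^sub>U(y))\<close> for one constant \<open>D\<close>. The upper bound and
  condition \<open>(A)\<close> give a Lyapunov drift, the lower bound a minorization on sublevel sets of the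
  weights, and both together a contraction by the argument of Hairer and Mattingly.\<close>

section \<open>Sinkhorn potentials\<close>

text \<open>One Schroedinger half-step in logarithmic form, with the reference weight absorbed into
  \<open>M\<close>: for \<open>M = gibbs lam U\<close> it is the logarithm of \<open>K_flat\<close>
  at \<open>exp (- (U x + u x))\<close>. The other half-step is the same function with the arguments
  of \<open>W\<close> swapped.\<close>

definition log_transform :: "'a measure \<Rightarrow> ('a \<Rightarrow> 'b \<Rightarrow> real) \<Rightarrow> ('a \<Rightarrow> real) \<Rightarrow> 'b \<Rightarrow> real" where
  "log_transform M W u y = ln (LINT x|M. exp (- W x y) * exp (- u x))"

text \<open>The invariant of the iteration: integrability of \<open>u\<close> feeds Jensen's
  inequality, that of \<open>exp (- u x)\<close> keeps the next transform finite.\<close>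

definition admissible :: "'a measure \<Rightarrow> ('a \<Rightarrow> real) \<Rightarrow> bool" where
  "admissible M u \<longleftrightarrow> integrable M u \<and> integrable M (\<lambda>x. exp (- u x))"

text \<open>Jensen for the exponential: integrate its tangent line at the mean of
  \<open>f\<close>.\<close>

lemma (in prob_space) exp_integral_le:
  fixes f :: "'a \<Rightarrow> real"
  assumes "integrable M f" "integrable M (\<lambda>x. exp (f x))"
  shows "exp (LINT x|M. f x) \<le> (LINT x|M. exp (f x))"
proof -
  have "(LINT x|M. exp (expectation f) * (1 + (f x - expectation f))) \<le> (LINT x|M. exp (f x))"
  proof (rule integral_mono)
    fix x
    have "exp (expectation f) * (1 + (f x - expectation f))
        \<le> exp (expectation f) * exp (f x - expectation f)"
      by (intro mult_left_mono exp_ge_add_one_self) auto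
    then show "exp (expectation f) * (1 + (f x - expectation f)) \<le> exp (f x)"
      by (simp flip: exp_add)
  qed (use assms in auto)
  then show ?thesis
    using assms by (simp add: prob_space)
qed

text \<open>A frame symmetric in the two spaces: \<open>mu\<close> and \<open>eta\<close> stand for
  the Gibbs measures of \<open>U\<close> and \<open>V\<close>. Integrability of the exponentials of
  the averaged costs is derived from condition (A) later.\<close>

locale cost_pair = mu: prob_space mu + eta: prob_space eta
  for mu :: "'x::topological_space measure" and eta :: "'y::topological_space measure" +
  fixes W :: "'x \<Rightarrow> 'y \<Rightarrow> real" and c :: real
  assumes sets_mu [measurable_cong]: "sets mu = sets borel"
    and sets_eta [measurable_cong]: "sets eta = sets borel"
    and meas_W [measurable]: "case_prod W \<in> borel_measurable (borel \<Otimes>\<^sub>M borel)"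
    and exp_W_le: "exp (- W x y) \<le> c"
    and int_W1: "integrable eta (\<lambda>y. W x y)"
    and int_W2: "integrable mu (\<lambda>x. W x y)"
    and int_P: "integrable mu (\<lambda>x. exp (LINT y|eta. W x y))"
    and int_Q: "integrable eta (\<lambda>y. exp (LINT x|mu. W x y))"
begin

text \<open>Either half of a Sinkhorn iteration is the other one with the spaces exchanged, so each
  fact is proved on one side and transferred through this instance.\<close>

lemma dual: "cost_pair eta mu (\<lambda>y x. W x y) c"
proof
  show "case_prod (\<lambda>y x. W x y) \<in> borel_measurable (borel \<Otimes>\<^sub>M borel)"
    using meas_W by measurable
qed (use sets_mu sets_eta exp_W_le int_W1 int_W2 int_P int_Q in auto)

abbreviation P where "P x \<equiv> exp (LINT y|eta. W x y)"
abbreviation Q where "Q y \<equiv> exp (LINT x|mu. W x y)"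

lemma c_pos: "0 < c"
  using exp_W_le[of undefined undefined] exp_gt_zero less_le_trans by blast

lemma space_eta: "space eta = UNIV"
  using sets_eq_imp_space_eq[OF sets_eta] by simp

text \<open>The bound on \<open>exp (- W x y)\<close> says \<open>W x y \<ge> - ln c\<close>, which
  survives averaging. It serves for the zero potential at the start.\<close>

lemma P_ge: "1 \<le> c * P x"
proof -
  have "- ln c \<le> W x y" for y
    using ln_mono[OF exp_W_le[of x y]] c_pos by simp
  then have "(LINT y|eta. - ln c) \<le> (LINT y|eta. W x y)"
    by (intro integral_mono int_W1) auto
  then have "1 \<le> exp (ln c + (LINT y|eta. W x y))"
    by (simp add: eta.prob_space)
  then show ?thesis
    by (simp add: exp_add c_pos)
qed

section \<open>The transform of a single admissible potential\<close>

context
  fixes u assumes u: "admissible mu u"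
begin

lemma meas_u [measurable]: "u \<in> borel_measurable borel"
  using u unfolding admissible_def integrable_iff_bounded by (auto simp: measurable_cong_sets[OF sets_mu refl])

lemma int_u: "integrable mu u" and int_exp_u: "integrable mu (\<lambda>x. exp (- u x))"
  using u by (auto simp: admissible_def)

lemma integrable_kernel: "integrable mu (\<lambda>x. exp (- W x y) * exp (- u x))"
  by (rule Bochner_Integration.integrable_bound[OF integrable_mult_right[OF int_exp_u, of c]])
     (auto intro!: mult_right_mono exp_W_le simp: abs_mult abs_of_pos c_pos)

text \<open>Jensen applied to \<open>- W x y - u x\<close>; the averaged cost is moved to the right
  as the factor \<open>Q y\<close>.\<close>

lemma kernel_integral_ge: "exp (- (LINT x|mu. u x)) \<le> Q y * (LINT x|mu. exp (- W x y) * exp (- u x))"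
proof -
  have "exp (LINT x|mu. - W x y - u x) \<le> (LINT x|mu. exp (- W x y - u x))"
    using integrable_kernel[of y] int_u int_W2[of y]
    by (intro mu.exp_integral_le) (auto simp: exp_diff exp_minus field_simps)
  also have "(LINT x|mu. - W x y - u x) = - (LINT x|mu. W x y) - (LINT x|mu. u x)"
    using int_u int_W2[of y] by simp
  finally show ?thesis
    by (simp add: exp_diff exp_minus field_simps)
qed

lemma kernel_integral_pos: "0 < (LINT x|mu. exp (- W x y) * exp (- u x))"
  using kernel_integral_ge[of y] exp_gt_zero[of "- (LINT x|mu. u x)"]
  by (meson exp_gt_zero less_le_trans zero_less_mult_pos)

lemma exp_log_transform: "exp (log_transform mu W u y) = (LINT x|mu. exp (- W x y) * exp (- u x))"
  using kernel_integral_pos by (simp add: log_transform_def)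

lemma exp_minus_log_transform_le: "exp (- log_transform mu W u y) \<le> Q y * exp (LINT x|mu. u x)"
proof -
  have "exp (- (LINT x|mu. u x)) \<le> Q y * exp (log_transform mu W u y)"
    using kernel_integral_ge[of y] by (simp add: exp_log_transform)
  then show ?thesis
    by (simp add: exp_minus field_simps)
qed

lemma exp_log_transform_le: "exp (log_transform mu W u y) \<le> c * (LINT x|mu. exp (- u x))"
proof -
  have "(LINT x|mu. exp (- W x y) * exp (- u x)) \<le> (LINT x|mu. c * exp (- u x))"
    by (intro integral_mono integrable_kernel) (auto intro!: mult_right_mono exp_W_le int_exp_u)
  then show ?thesis by (simp add: exp_log_transform)
qed

lemma meas_log_transform [measurable]: "log_transform mu W u \<in> borel_measurable borel"
  unfolding log_transform_def by measurable

lemma admissible_log_transform: "admissible eta (log_transform mu W u)"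
proof -
  let ?v = "log_transform mu W u" and ?B = "c * (LINT x|mu. exp (- u x))"
  have B: "0 < ?B"
    using exp_log_transform_le[of undefined] exp_gt_zero less_le_trans by blast
  \<comment> \<open>An integrable dominating function: \<open>?v\<close> is bounded above by a
    constant and below by Jensen's inequality, where \<open>t \<le> exp t\<close> replaces the
    averaged cost by \<open>Q y\<close>.\<close>
  have "\<bar>?v y\<bar> \<le> Q y + (\<bar>LINT x|mu. u x\<bar> + \<bar>ln ?B\<bar>)" for y
  proof -
    have "?v y \<le> ln ?B"
      using exp_log_transform_le[of y] B ln_ge_iff by blast
    moreover have "- ?v y \<le> (LINT x|mu. W x y) + (LINT x|mu. u x)"
      using exp_minus_log_transform_le[of y] by (simp flip: exp_add)
    moreover have "(LINT x|mu. W x y) \<le> Q y"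
      using exp_ge_add_one_self[of "LINT x|mu. W x y"] by linarith
    ultimately show ?thesis using exp_gt_zero[of "LINT x|mu. W x y"] by linarith
  qed
  then have *: "norm (?v y) \<le> norm (Q y + (\<bar>LINT x|mu. u x\<bar> + \<bar>ln ?B\<bar>))" for y
    unfolding real_norm_def by (rule order_trans[OF _ abs_ge_self])
  have "integrable eta ?v"
  proof (rule Bochner_Integration.integrable_bound)
    show "AE y in eta. norm (?v y) \<le> norm (Q y + (\<bar>LINT x|mu. u x\<bar> + \<bar>ln ?B\<bar>))"
      by (rule AE_I2) (rule * )
  qed (auto intro!: Bochner_Integration.integrable_add int_Q)
  moreover have "integrable eta (\<lambda>y. exp (- ?v y))"
    by (rule Bochner_Integration.integrable_bound[OF integrable_mult_left[OF int_Q, of "exp (LINT x|mu. u x)"]])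
       (auto simp: exp_minus_log_transform_le)
  ultimately show ?thesis
    by (simp add: admissible_def)
qed

end

text \<open>One full Sinkhorn iteration \<open>u \<mapsto> u'\<close> changes \<open>\<mu>\<close> into the probability measure
  \<open>e\<^bsup>u'-u\<^esup> \<mu>\<close>; hence \<open>\<mu>(u') \<le> \<mu>(u)\<close> by \<open>1 + t \<le> e\<^sup>t\<close>.\<close>

lemma integral_log_transform_twice_le:
  assumes u: "admissible mu u"
  defines "v \<equiv> log_transform mu W u"
  defines "u' \<equiv> log_transform eta (\<lambda>y x. W x y) v"
  shows "(LINT x|mu. u' x) \<le> (LINT x|mu. u x)"
proof -
  interpret D: cost_pair eta mu "\<lambda>y x. W x y" c by (rule dual)
  interpret pair_sigma_finite mu eta ..
  have v: "admissible eta v" unfolding v_def using u by (rule admissible_log_transform)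
  have u': "admissible mu u'" unfolding u'_def using v by (rule D.admissible_log_transform)
  note [measurable] = meas_u[OF u] D.meas_u[OF v] meas_u[OF u']
  \<comment> \<open>Tonelli for the joint density
    \<open>exp (- u x) * exp (- W x y) * exp (- v y)\<close>: integrating out \<open>y\<close>
    leaves \<open>exp (u' x - u x)\<close>, integrating out \<open>x\<close> leaves 1, because
    \<open>v\<close> normalises the second marginal to \<open>eta\<close>.\<close>
  have "(\<integral>\<^sup>+ x. ennreal (exp (u' x - u x)) \<partial>mu)
      = (\<integral>\<^sup>+ x. (\<integral>\<^sup>+ y. ennreal (exp (- u x) * exp (- W x y) * exp (- v y)) \<partial>eta) \<partial>mu)"
  proof (rule nn_integral_cong)
    fix x
    have "(\<integral>\<^sup>+ y. ennreal (exp (- u x) * exp (- W x y) * exp (- v y)) \<partial>eta)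
        = ennreal (exp (- u x)) * (\<integral>\<^sup>+ y. ennreal (exp (- W x y) * exp (- v y)) \<partial>eta)"
      by (subst nn_integral_cmult[symmetric]) (auto simp: mult.assoc simp flip: ennreal_mult)
    also have "\<dots> = ennreal (exp (- u x)) * ennreal (exp (u' x))"
      using D.integrable_kernel[OF v, of x]
      by (subst nn_integral_eq_integral) (auto simp: u'_def D.exp_log_transform[OF v])
    finally show "ennreal (exp (u' x - u x)) = (\<integral>\<^sup>+ y. ennreal (exp (- u x) * exp (- W x y) * exp (- v y)) \<partial>eta)"
      by (simp flip: ennreal_mult exp_add)
  qed
  also have "\<dots> = (\<integral>\<^sup>+ y. (\<integral>\<^sup>+ x. ennreal (exp (- u x) * exp (- W x y) * exp (- v y)) \<partial>mu) \<partial>eta)"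
    by (rule Fubini'[symmetric]) measurable
  also have "\<dots> = (\<integral>\<^sup>+ y. 1 \<partial>eta)"
  proof (rule nn_integral_cong)
    fix y
    have "(\<integral>\<^sup>+ x. ennreal (exp (- u x) * exp (- W x y) * exp (- v y)) \<partial>mu)
        = ennreal (exp (- v y)) * (\<integral>\<^sup>+ x. ennreal (exp (- W x y) * exp (- u x)) \<partial>mu)"
      by (subst nn_integral_cmult[symmetric]) (auto simp: ac_simps simp flip: ennreal_mult)
    also have "\<dots> = ennreal (exp (- v y)) * ennreal (exp (v y))"
      using integrable_kernel[OF u, of y]
      by (subst nn_integral_eq_integral) (auto simp: v_def exp_log_transform[OF u])
    finally show "(\<integral>\<^sup>+ x. ennreal (exp (- u x) * exp (- W x y) * exp (- v y)) \<partial>mu) = 1"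
      by (simp flip: ennreal_mult exp_add)
  qed
  also have "\<dots> = ennreal 1"
    by (simp add: eta.emeasure_space_1)
  finally have *: "(\<integral>\<^sup>+ x. ennreal (exp (u' x - u x)) \<partial>mu) = ennreal 1" .
  then have "integrable mu (\<lambda>x. exp (u' x - u x)) \<and> (LINT x|mu. exp (u' x - u x)) = 1"
    by (subst (asm) nn_integral_eq_integrable) auto
  moreover have "integrable mu (\<lambda>x. u' x - u x)"
    using int_u[OF u] int_u[OF u'] by simp
  ultimately have "exp (LINT x|mu. u' x - u x) \<le> 1"
    using mu.exp_integral_le by metis
  then show ?thesis
    using int_u[OF u] int_u[OF u'] by simp
qed

end

text \<open>For \<open>\<mu> = \<lambda>\<^sub>U\<close> and \<open>\<eta> = \<nu>\<^sub>V\<close>, the iterate \<open>n\<close> is \<open>U\<^sub>2\<^sub>n - U\<close>, and its \<open>log_transform\<close> is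
  \<open>V\<^sub>2\<^sub>n\<^sub>+\<^sub>1 - V\<close>.\<close>

primrec potential :: "'x measure \<Rightarrow> 'y measure \<Rightarrow> ('x \<Rightarrow> 'y \<Rightarrow> real) \<Rightarrow> nat \<Rightarrow> 'x \<Rightarrow> real" where
  "potential mu eta W 0 = (\<lambda>_. 0)"
| "potential mu eta W (Suc n) =
     log_transform eta (\<lambda>y x. W x y) (log_transform mu W (potential mu eta W n))"

section \<open>Bounds on the potentials that are uniform along the iteration\<close>

context cost_pair
begin

abbreviation "pot \<equiv> potential mu eta W"
abbreviation "copot n \<equiv> log_transform mu W (pot n)"

lemma admissible_potential: "admissible mu (pot n)"
proof (induction n)
  case 0
  then show ?case by (simp add: admissible_def)
next
  case (Suc n)
  then show ?case
    by (simp add: admissible_log_transform cost_pair.admissible_log_transform[OF dual])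
qed

lemma admissible_copotential: "admissible eta (copot n)"
  by (rule admissible_log_transform[OF admissible_potential])

lemma integral_potential_le: "(LINT x|mu. pot n x) \<le> 0"
  by (induction n)
    (auto intro: order_trans[OF integral_log_transform_twice_le[OF admissible_potential]])

lemma integral_copotential_le: "(LINT y|eta. copot n y) \<le> ln c"
proof (induction n)
  case 0
  \<comment> \<open>\<open>pot 0\<close> vanishes, so this is the logarithm of the
    \<open>mu\<close>-mean of \<open>exp (- W x y)\<close>.\<close>
  have "copot 0 y \<le> ln c" for y
    using exp_log_transform_le[OF admissible_potential[of 0], of y] c_pos
    by (simp add: mu.prob_space ln_ge_iff)
  then have "(LINT y|eta. copot 0 y) \<le> (LINT y|eta. ln c)"
    using cost_pair.int_u[OF dual admissible_copotential, of 0] by (intro integral_mono) auto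
  then show ?case by (simp add: eta.prob_space)
next
  case (Suc n)
  \<comment> \<open>\<open>copot (Suc n)\<close> is the double transform of \<open>copot n\<close>
    started from the other space, so the monotonicity of means applies in its dual form.\<close>
  show ?case
    using cost_pair.integral_log_transform_twice_le[OF dual admissible_copotential, of n] Suc by simp
qed

lemma exp_minus_copotential_le: "exp (- copot n y) \<le> Q y"
proof -
  have "exp (- copot n y) \<le> Q y * exp (LINT x|mu. pot n x)"
    by (rule exp_minus_log_transform_le[OF admissible_potential])
  also have "\<dots> \<le> Q y * 1"
    by (intro mult_left_mono) (auto simp: integral_potential_le)
  finally show ?thesis by simp
qed

text \<open>The factor \<open>c\<close> comes from the bound \<open>ln c\<close> on the mean of the
  preceding copotential. For \<open>n = 0\<close>, where no copotential precedes,
  \<open>P_ge\<close> gives the same bound.\<close>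

lemma exp_minus_potential_le: "exp (- pot n x) \<le> c * P x"
proof (cases n)
  case 0
  then show ?thesis using P_ge[of x] by simp
next
  case (Suc m)
  have "exp (- pot n x) \<le> P x * exp (LINT y|eta. copot m y)"
    using cost_pair.exp_minus_log_transform_le[OF dual admissible_copotential, of m x]
    by (simp add: Suc)
  also have "\<dots> \<le> P x * exp (ln c)"
    by (rule mult_left_mono) (auto simp only: exp_le_cancel_iff integral_copotential_le exp_ge_zero)
  finally show ?thesis by (simp add: c_pos mult.commute)
qed

text \<open>A lower bound on the potential turns into an upper bound on the copotential: in the
  crude estimate by \<open>c\<close> times the mean of \<open>exp (- pot n x)\<close>, the integrand
  is dominated by \<open>c * P x\<close>.\<close>

lemma exp_copotential_le: "exp (copot n y) \<le> c\<^sup>2 * (LINT x|mu. P x)"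
proof -
  have "(LINT x|mu. exp (- pot n x)) \<le> (LINT x|mu. c * P x)"
    by (rule integral_mono[OF int_exp_u[OF admissible_potential] integrable_mult_right[OF int_P]
          exp_minus_potential_le])
  then have "c * (LINT x|mu. exp (- pot n x)) \<le> c * (c * (LINT x|mu. P x))"
    using c_pos by (intro mult_left_mono) auto
  then show ?thesis
    using exp_log_transform_le[OF admissible_potential, of n y]
    by (simp add: power2_eq_square mult.assoc)
qed

text \<open>The same argument from the other space. The index is a successor because those
  potentials are log transforms of copotentials.\<close>

lemma exp_potential_Suc_le: "exp (pot (Suc n) x) \<le> c * (LINT y|eta. Q y)"
proof -
  have "(LINT y|eta. exp (- copot n y)) \<le> (LINT y|eta. Q y)"
    by (rule integral_mono[OF cost_pair.int_exp_u[OF dual admissible_copotential] int_Q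
          exp_minus_copotential_le])
  then have "c * (LINT y|eta. exp (- copot n y)) \<le> c * (LINT y|eta. Q y)"
    using c_pos by (intro mult_left_mono) auto
  then show ?thesis
    using cost_pair.exp_log_transform_le[OF dual admissible_copotential, of n x] by simp
qed

end

section \<open>Contraction of weighted total variation norms\<close>

text \<open>The supremum over partitions is attained by splitting along the sign of
  \<open>f1 - f2\<close>, an explicit Hahn decomposition.\<close>

lemma total_variation_density_diff:
  fixes f1 f2 :: "'a \<Rightarrow> real"
  assumes f1: "integrable M f1" and f2: "integrable M f2"
    and m: "\<And>A. A \<in> sets M \<Longrightarrow> m A = (LINT x:A|M. f1 x) - (LINT x:A|M. f2 x)"
  shows "total_variation M m = density M (\<lambda>x. ennreal \<bar>f1 x - f2 x\<bar>)"
proof -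
  define d where "d x = f1 x - f2 x" for x
  have d: "integrable M d" unfolding d_def using f1 f2 by simp
  have [measurable]: "d \<in> borel_measurable M" using d by auto
  have m_d: "m A = (LINT x:A|M. d x)" if "A \<in> sets M" for A
    unfolding d_def m[OF that] set_integral_diff(2)[OF integrable_mult_indicator[OF that f1, folded set_integrable_def]
      integrable_mult_indicator[OF that f2, folded set_integrable_def]] ..
  have abs_m: "\<bar>m A\<bar> \<le> (LINT x:A|M. \<bar>d x\<bar>)" if "A \<in> sets M" for A
    unfolding m_d[OF that] set_lebesgue_integral_def
    using integral_norm_bound[of M "\<lambda>x. indicator A x *\<^sub>R d x"] by (simp add: abs_mult)
  have em: "emeasure (density M (\<lambda>x. ennreal \<bar>d x\<bar>)) A = ennreal (LINT x:A|M. \<bar>d x\<bar>)" if "A \<in> sets M" for A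
  proof -
    have "emeasure (density M (\<lambda>x. ennreal \<bar>d x\<bar>)) A = (\<integral>\<^sup>+x. ennreal (indicator A x *\<^sub>R \<bar>d x\<bar>) \<partial>M)"
      using that by (subst emeasure_density) (auto intro!: nn_integral_cong split: split_indicator)
    also have "\<dots> = ennreal (LINT x:A|M. \<bar>d x\<bar>)"
      unfolding set_lebesgue_integral_def using that d
      by (intro nn_integral_eq_integral integrable_mult_indicator) (auto split: split_indicator)
    finally show ?thesis .
  qed
  have "(SUP P\<in>{P. finite P \<and> partition_on A P \<and> P \<subseteq> sets M}. \<Sum>B\<in>P. ennreal \<bar>m B\<bar>)
      = emeasure (density M (\<lambda>x. ennreal \<bar>d x\<bar>)) A" (is "?S = ?E") if A: "A \<in> sets M" for A
  proof (rule antisym)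
    \<comment> \<open>On each block the absolute value moves inside the integral, and the blocks add
      up to \<open>A\<close>.\<close>
    show "?S \<le> ?E"
    proof (rule SUP_least)
      fix P assume "P \<in> {P. finite P \<and> partition_on A P \<and> P \<subseteq> sets M}"
      then have P: "finite P" "\<Union>P = A" "disjoint P" "P \<subseteq> sets M"
        by (auto simp: partition_on_def)
      have "(\<Sum>B\<in>P. ennreal \<bar>m B\<bar>) \<le> (\<Sum>B\<in>P. emeasure (density M (\<lambda>x. ennreal \<bar>d x\<bar>)) B)"
        using P by (intro sum_mono) (auto simp: em intro!: ennreal_leI abs_m)
      also have "\<dots> = emeasure (density M (\<lambda>x. ennreal \<bar>d x\<bar>)) (\<Union>B\<in>P. B)"
        using P by (intro sum_emeasure) (auto simp: disjoint_def disjoint_family_on_def)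
      finally show "(\<Sum>B\<in>P. ennreal \<bar>m B\<bar>) \<le> ?E" using P by simp
    qed
  next
    define A1 where "A1 = A \<inter> {x\<in>space M. 0 \<le> d x}"
    define A2 where "A2 = A \<inter> {x\<in>space M. d x < 0}"
    have [measurable]: "A1 \<in> sets M"
      unfolding A1_def by (rule sets.Int[OF A]) measurable
    have [measurable]: "A2 \<in> sets M"
      unfolding A2_def by (rule sets.Int[OF A]) measurable
    have A12: "A1 \<union> A2 = A" "A1 \<inter> A2 = {}"
      using sets.sets_into_space[OF A] by (auto simp: A1_def A2_def)
    \<comment> \<open>Blocks of a \<open>partition_on\<close> are non-empty, so an empty half has to
      be dropped; it contributes \<open>m {} = 0\<close> anyway.\<close>
    define P where "P = {A1, A2} - {{}}"
    have P: "finite P" "partition_on A P" "P \<subseteq> sets M"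
      using A12 by (auto simp: P_def partition_on_def disjoint_def)
    have "m {} = 0" by (simp add: m_d set_lebesgue_integral_def)
    have "(LINT x:A1|M. \<bar>d x\<bar>) = m A1"
      unfolding m_d[OF \<open>A1 \<in> sets M\<close>]
      by (rule set_lebesgue_integral_cong[OF \<open>A1 \<in> sets M\<close>]) (auto simp: A1_def)
    moreover have "(LINT x:A2|M. \<bar>d x\<bar>) = (LINT x:A2|M. - d x)"
      by (rule set_lebesgue_integral_cong[OF \<open>A2 \<in> sets M\<close>]) (auto simp: A2_def)
    moreover have "(LINT x:A2|M. - d x) = - m A2"
      unfolding m_d[OF \<open>A2 \<in> sets M\<close>] by (simp add: set_lebesgue_integral_def)
    ultimately have E_eq: "(LINT x:A1|M. \<bar>d x\<bar>) = m A1" "(LINT x:A2|M. \<bar>d x\<bar>) = - m A2"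
      by simp_all
    have "?E = emeasure (density M (\<lambda>x. ennreal \<bar>d x\<bar>)) A1
        + emeasure (density M (\<lambda>x. ennreal \<bar>d x\<bar>)) A2"
      using A12 by (subst plus_emeasure) auto
    also have "\<dots> \<le> ennreal \<bar>m A1\<bar> + ennreal \<bar>m A2\<bar>"
      by (simp add: em E_eq) (intro add_mono ennreal_leI; simp)
    also have "\<dots> = (\<Sum>B\<in>P. ennreal \<bar>m B\<bar>)"
      using A12 \<open>m {} = 0\<close> by (cases "A1 = {}"; cases "A2 = {}"; cases "A1 = A2") (auto simp: P_def insert_Diff_if)
    also have "\<dots> \<le> ?S"
      using P by (intro SUP_upper) auto
    finally show "?E \<le> ?S" .
  qed
  then have "total_variation M m
      = measure_of (space M) (sets M) (emeasure (density M (\<lambda>x. ennreal \<bar>d x\<bar>)))"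
    unfolding total_variation_def
    by (intro measure_of_eq sets.space_closed) (simp add: sets.sigma_sets_eq)
  also have "\<dots> = density M (\<lambda>x. ennreal \<bar>d x\<bar>)"
    using measure_of_of_measure[of "density M (\<lambda>x. ennreal \<bar>d x\<bar>)"] by simp
  finally show ?thesis by (simp add: d_def)
qed

text \<open>The reference measure is the equal mixture of \<open>N1\<close> and \<open>N2\<close>,
  built by binding over a fair coin. It dominates both, so both have Radon-Nikodym densities, chosen
  real valued.\<close>

lemma obtain_common_density:
  assumes N1: "prob_space N1" "sets N1 = sets borel" and N2: "prob_space N2" "sets N2 = sets borel"
  obtains M :: "'a::topological_space measure" and f1 f2 :: "'a \<Rightarrow> real"
  where "sets M = sets borel" "f1 \<in> borel_measurable borel" "f2 \<in> borel_measurable borel"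
    "\<And>x. 0 \<le> f1 x" "\<And>x. 0 \<le> f2 x"
    "N1 = density M (\<lambda>x. ennreal (f1 x))" "N2 = density M (\<lambda>x. ennreal (f2 x))"
proof -
  define L where "L b = (if b then N1 else N2)" for b
  define M where "M = measure_pmf (bernoulli_pmf (1/2)) \<bind> L"
  have L: "L \<in> measurable (measure_pmf (bernoulli_pmf (1/2))) (prob_algebra borel)"
    using N1 N2 by (auto simp: L_def space_prob_algebra)
  have p: "measure_pmf (bernoulli_pmf (1/2)) \<in> space (prob_algebra (measure_pmf (bernoulli_pmf (1/2))))"
    by (simp add: space_prob_algebra prob_space_measure_pmf)
  have em: "emeasure M A = ennreal (1/2) * emeasure N1 A + ennreal (1/2) * emeasure N2 A" if "A \<in> sets borel" for A
    unfolding M_def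
    by (subst emeasure_bind_prob_algebra[OF p L that]) (simp add: L_def mult.commute)
  have sM: "sets M = sets borel"
    unfolding M_def by (rule sets_bind) (use N1 N2 in \<open>auto simp: L_def\<close>)
  interpret M: prob_space M
    unfolding M_def by (rule prob_space_bind'[OF p L])
  have ex: "\<exists>f. f \<in> borel_measurable borel \<and> (\<forall>x. 0 \<le> f x) \<and> N = density M (\<lambda>x. ennreal (f x :: real))"
    if "N \<in> {N1, N2}" for N
  proof -
    have N: "sets N = sets M" "finite_measure N" using that N1 N2 sM prob_space.finite_measure by auto
    have ac: "absolutely_continuous M N"
      unfolding absolutely_continuous_def using that N1 N2
      by (auto simp: null_sets_def sM em)
    from M.real_RN_deriv[OF N(2) ac N(1)] obtain D where D: "D \<in> borel_measurable M"
      "AE x in M. RN_deriv M N x = ennreal (D x)" "\<And>x. 0 \<le> D x"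
      by metis
    have "N = density M (RN_deriv M N)"
      using M.density_RN_deriv[OF ac N(1)] by simp
    also have "\<dots> = density M (\<lambda>x. ennreal (D x))"
      using D by (intro density_cong) auto
    finally show ?thesis using D by (auto simp: measurable_cong_sets[OF sM refl])
  qed
  show ?thesis using ex[of N1] ex[of N2] that sM by fastforce
qed

text \<open>The weighted total variation norm is a dual norm: it controls every test function
  dominated by a multiple of \<open>g\<close>, and a signed copy of \<open>g\<close> attains it.
  This replaces signed measures by pairs of integrals from here on.\<close>

lemma weighted_tv_norm_dual:
  fixes N1 N2 :: "'a::topological_space measure"
  assumes N1: "N1 \<in> Prob_weighted g" and N2: "N2 \<in> Prob_weighted g"
    and g[measurable]: "g \<in> borel_measurable borel" and g0: "\<And>x. 0 \<le> g x"
  obtains t where "0 \<le> t" "weighted_tv_norm g (\<lambda>A. measure N1 A - measure N2 A) = ennreal t"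
    "\<And>F b. \<lbrakk>F \<in> borel_measurable borel; \<And>x. \<bar>F x\<bar> \<le> b * g x\<rbrakk>
      \<Longrightarrow> (LINT x|N1. F x) - (LINT x|N2. F x) \<le> b * t"
    "\<exists>s\<in>borel_measurable borel. (\<forall>x. \<bar>s x\<bar> = g x) \<and> (LINT x|N1. s x) - (LINT x|N2. s x) = t"
proof -
  have N: "prob_space N1" "sets N1 = sets borel" "prob_space N2" "sets N2 = sets borel"
    and fin: "(\<integral>\<^sup>+ x. ennreal (g x) \<partial>N1) < \<infinity>" "(\<integral>\<^sup>+ x. ennreal (g x) \<partial>N2) < \<infinity>"
    using N1 N2 by (auto simp: Prob_weighted_def)
  obtain M :: "'a measure" and f1 f2 :: "'a \<Rightarrow> real" where
    sM [measurable_cong]: "sets M = sets borel"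
    and f[measurable]: "f1 \<in> borel_measurable borel" "f2 \<in> borel_measurable borel"
    and f0: "\<And>x. 0 \<le> f1 x" "\<And>x. 0 \<le> f2 x"
    and N_eq: "N1 = density M (\<lambda>x. ennreal (f1 x))" "N2 = density M (\<lambda>x. ennreal (f2 x))"
    using obtain_common_density[OF N] by blast
  have int_gN: "integrable N1 g" "integrable N2 g"
    using fin g0 g by (auto intro!: integrableI_nonneg simp: measurable_cong_sets[OF N(2) refl] measurable_cong_sets[OF N(4) refl])
  have int_f: "integrable M f1" "integrable M f2"
    using N(1,3)[THEN prob_space.emeasure_space_1]
    by (auto intro!: integrableI_nonneg simp: N_eq f0 emeasure_density nn_integral_set_ennreal[symmetric] cong: nn_integral_cong)
  have int_fg: "integrable M (\<lambda>x. f1 x * g x)" "integrable M (\<lambda>x. f2 x * g x)"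
    using int_gN by (auto simp: N_eq integrable_density f0)
  have LN: "(LINT x|N1. F x) = (LINT x|M. f1 x * F x)" "(LINT x|N2. F x) = (LINT x|M. f2 x * F x)"
    if [measurable]: "F \<in> borel_measurable borel" for F
    unfolding N_eq by (subst integral_density; simp add: f0)+
  have meas: "measure N1 A = (LINT x:A|M. f1 x)" "measure N2 A = (LINT x:A|M. f2 x)" if A[measurable]: "A \<in> sets M" for A
  proof -
    have "A \<in> sets N1" "A \<in> sets N2" using A N sM by auto
    moreover have "indicator A \<in> borel_measurable borel" using A sM by simp
    ultimately show "measure N1 A = (LINT x:A|M. f1 x)" "measure N2 A = (LINT x:A|M. f2 x)"
      using LN[of "indicator A"] by (simp_all add: set_lebesgue_integral_def mult.commute)
  qed
  \<comment> \<open>With common densities the norm is the integral of \<open>w\<close>, finite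
    because \<open>\<bar>f1 x - f2 x\<bar> \<le> f1 x + f2 x\<close>.\<close>
  define w where "w x = \<bar>f1 x - f2 x\<bar> * g x" for x
  have [measurable]: "w \<in> borel_measurable borel" unfolding w_def by measurable
  have int_w: "integrable M w"
  proof (rule Bochner_Integration.integrable_bound[OF Bochner_Integration.integrable_add[OF int_fg]])
    have "\<bar>f1 x - f2 x\<bar> * g x \<le> (f1 x + f2 x) * g x" for x
      using f0[of x] g0[of x] by (intro mult_right_mono) auto
    then have "norm (w x) \<le> norm (f1 x * g x + f2 x * g x)" for x
      using f0[of x] g0[of x] by (simp add: w_def abs_mult distrib_right)
    then show "AE x in M. norm (w x) \<le> norm (f1 x * g x + f2 x * g x)" by simp
  qed simp
  \<comment> \<open>The definition of \<open>total_variation\<close> reads its first argument only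
    through \<open>space\<close> and \<open>sets\<close>, which \<open>M\<close> shares with
    \<open>borel\<close>.\<close>
  have "total_variation borel (\<lambda>A. measure N1 A - measure N2 A)
      = total_variation M (\<lambda>A. measure N1 A - measure N2 A)"
    by (simp add: total_variation_def sM sets_eq_imp_space_eq[OF sM])
  also have "\<dots> = density M (\<lambda>x. ennreal \<bar>f1 x - f2 x\<bar>)"
    by (rule total_variation_density_diff[OF int_f]) (simp add: meas)
  finally have "weighted_tv_norm g (\<lambda>A. measure N1 A - measure N2 A)
      = (\<integral>\<^sup>+ x. ennreal (w x) \<partial>M)"
    by (simp add: weighted_tv_norm_def nn_integral_density w_def ennreal_mult g0)
  also have "\<dots> = ennreal (LINT x|M. w x)"
    by (rule nn_integral_eq_integral[OF int_w]) (auto simp: w_def g0)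
  finally have tv: "weighted_tv_norm g (\<lambda>A. measure N1 A - measure N2 A) = ennreal (LINT x|M. w x)" .
  have int_F: "integrable M (\<lambda>x. f1 x * F x)" "integrable M (\<lambda>x. f2 x * F x)"
    if [measurable]: "F \<in> borel_measurable borel" and le: "\<And>x. \<bar>F x\<bar> \<le> b * g x" for F b
  proof -
    have "norm (f x * F x) \<le> norm (b * (f x * g x))" if "0 \<le> f x" for f x
    proof -
      have "f x * \<bar>F x\<bar> \<le> f x * (b * g x)" using le that by (intro mult_left_mono)
      then have "norm (f x * F x) \<le> b * (f x * g x)" using that by (simp add: abs_mult algebra_simps)
      then show ?thesis unfolding real_norm_def by (rule order_trans[OF _ abs_ge_self])
    qed
    then show "integrable M (\<lambda>x. f1 x * F x)" "integrable M (\<lambda>x. f2 x * F x)"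
      using f0 by (intro Bochner_Integration.integrable_bound[OF integrable_mult_right[OF int_fg(1), of b]]
        Bochner_Integration.integrable_bound[OF integrable_mult_right[OF int_fg(2), of b]]; simp)+
  qed
  show ?thesis
  proof (rule that[OF _ tv])
    show "0 \<le> (LINT x|M. w x)" by (intro integral_nonneg_AE) (auto simp: w_def g0)
  next
    fix F b assume F: "F \<in> borel_measurable borel" "\<And>x. \<bar>F x\<bar> \<le> b * g x"
    have "(LINT x|N1. F x) - (LINT x|N2. F x) = (LINT x|M. (f1 x - f2 x) * F x)"
      using int_F[OF F] by (simp add: LN F(1) algebra_simps)
    also have "\<dots> \<le> (LINT x|M. b * w x)"
    proof (rule integral_mono)
      show "integrable M (\<lambda>x. (f1 x - f2 x) * F x)"
        using int_F[OF F] by (simp add: algebra_simps)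
      fix x
      have "(f1 x - f2 x) * F x \<le> \<bar>f1 x - f2 x\<bar> * \<bar>F x\<bar>"
        by (metis abs_ge_self abs_mult)
      also have "\<dots> \<le> \<bar>f1 x - f2 x\<bar> * (b * g x)" by (intro mult_left_mono F) auto
      finally show "(f1 x - f2 x) * F x \<le> b * w x" by (simp add: w_def algebra_simps)
    qed (use int_w in auto)
    finally show "(LINT x|N1. F x) - (LINT x|N2. F x) \<le> b * (LINT x|M. w x)" by simp
  next
    \<comment> \<open>The extremal test function is the sign of \<open>f1 - f2\<close> times
      \<open>g\<close>.\<close>
    define s where "s x = (if f2 x \<le> f1 x then g x else - g x)" for x
    have s: "s \<in> borel_measurable borel" unfolding s_def by measurable
    have s_le: "\<bar>s x\<bar> \<le> 1 * g x" for x by (simp add: s_def g0)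
    have "(LINT x|N1. s x) - (LINT x|N2. s x) = (LINT x|M. w x)"
      unfolding LN[OF s] Bochner_Integration.integral_diff[OF int_F[OF s s_le], symmetric]
      by (intro Bochner_Integration.integral_cong) (auto simp: s_def w_def algebra_simps)
    with s show "\<exists>s\<in>borel_measurable borel. (\<forall>x. \<bar>s x\<bar> = g x) \<and> (LINT x|N1. s x) - (LINT x|N2. s x) = (LINT x|M. w x)"
      by (auto simp: s_def g0 intro!: bexI[of _ s])
  qed
qed


section \<open>Integrals under dominated measures and under kernels\<close>

lemma integral_mono_measure_nonneg:
  fixes f :: "'a \<Rightarrow> real"
  assumes "sets M = sets N" "M \<le> N" "integrable N f" "\<And>x. 0 \<le> f x"
  shows "integrable M f" "(LINT x|M. f x) \<le> (LINT x|N. f x)"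
proof -
  have f: "f \<in> borel_measurable M"
    using assms by (simp add: measurable_cong_sets[OF assms(1) refl] borel_measurable_integrable)
  have le: "(\<integral>\<^sup>+ x. ennreal (f x) \<partial>M) \<le> ennreal (LINT x|N. f x)"
    using nn_integral_mono_measure[OF assms(1,2)] assms(3,4) by (metis AE_I2 nn_integral_eq_integral)
  then show i: "integrable M f"
    using f assms(4) by (intro integrableI_nonneg) (auto simp: top_unique less_top[symmetric])
  show "(LINT x|M. f x) \<le> (LINT x|N. f x)"
    using le assms(4) by (simp add: nn_integral_eq_integral[OF i] integral_nonneg_AE)
qed

text \<open>Both sides pass through nonnegative integrals. If the value is infinite, both default to
  0, so integrability of the outer integrand is no concern.\<close>

lemma integral_bind_nonneg:
  fixes f :: "'b \<Rightarrow> real"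
  assumes f: "f \<in> borel_measurable N" and L: "L \<in> M \<rightarrow>\<^sub>M subprob_algebra N"
    and "space M \<noteq> {}" and nonneg: "\<And>y. 0 \<le> f y" and int: "\<And>x. x \<in> space M \<Longrightarrow> integrable (L x) f"
  shows "(LINT y|(M \<bind> L). f y) = (LINT x|M. LINT y|L x. f y)"
proof -
  have "sets (M \<bind> L) = sets N"
    using assms(3) subprob_measurableD(2)[OF L] by (intro sets_bind) auto
  then have "(LINT y|(M \<bind> L). f y) = enn2real (\<integral>\<^sup>+ y. ennreal (f y) \<partial>(M \<bind> L))"
    using f nonneg by (intro integral_eq_nn_integral) (auto cong: measurable_cong_sets)
  also have "(\<integral>\<^sup>+ y. ennreal (f y) \<partial>(M \<bind> L)) = (\<integral>\<^sup>+ x. \<integral>\<^sup>+ y. ennreal (f y) \<partial>L x \<partial>M)"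
    using f L by (intro nn_integral_bind) auto
  also have "\<dots> = (\<integral>\<^sup>+ x. ennreal (LINT y|L x. f y) \<partial>M)"
    using int nonneg by (intro nn_integral_cong nn_integral_eq_integral) auto
  also have "enn2real \<dots> = (LINT x|M. LINT y|L x. f y)"
    using f L nonneg
    by (intro integral_eq_nn_integral[symmetric])
       (auto intro!: integral_nonneg_AE measurable_compose[OF L] integral_measurable_subprob_algebra)
  finally show ?thesis .
qed

text \<open>The argument of Hairer and Mattingly: a function \<open>F\<close> with
  \<open>F x - F x' \<le> \<rho> (g x + g x')\<close> differs from a constant by at most \<open>\<rho> g\<close>, and constants do
  not contribute to the difference of the integrals of \<open>F\<close> under two probability measures.\<close>

lemma weighted_oscillation:
  fixes F g :: "'a \<Rightarrow> real"
  assumes "\<And>x x'. F x - F x' \<le> \<rho> * (g x + g x')"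
  obtains b where "\<And>x. \<bar>F x - b\<bar> \<le> \<rho> * g x"
proof
  \<comment> \<open>The hypothesis puts every value of \<open>F - \<rho> g\<close> below every value
    of \<open>F + \<rho> g\<close>, so the infimum of the latter separates them.\<close>
  define b where "b = (INF x. F x + \<rho> * g x)"
  have le: "F x - \<rho> * g x \<le> F x' + \<rho> * g x'" for x x'
    using assms[of x x'] by (simp add: algebra_simps)
  fix x
  have "b \<le> F x + \<rho> * g x"
    unfolding b_def using le[of x] by (intro cINF_lower bdd_belowI2) auto
  moreover have "F x - \<rho> * g x \<le> b"
    unfolding b_def using le by (intro cINF_greatest) auto
  ultimately show "\<bar>F x - b\<bar> \<le> \<rho> * g x" by (simp add: abs_le_iff)
qed

text \<open>The hypotheses of Harris' theorem for a kernel between two different spaces. The weight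
  \<open>a\<close> is tuned by \<open>a * C = \<kappa> / 8\<close>, so that the level
  \<open>8 * C\<close> of \<open>g\<close> becomes the level \<open>\<kappa>\<close> of
  \<open>a * g\<close>. The minorizing measure \<open>m\<close> is not normalised;
  \<open>\<kappa>\<close> bounds its mass from below.\<close>

locale drift_minorization =
  fixes L :: "'a::topological_space \<Rightarrow> 'b::topological_space measure"
    and g :: "'a \<Rightarrow> real" and h :: "'b \<Rightarrow> real" and C \<kappa> a :: real and m :: "'b measure"
  assumes kernel: "L \<in> borel \<rightarrow>\<^sub>M prob_algebra borel"
    and meas_g [measurable]: "g \<in> borel_measurable borel" and g_nonneg: "\<And>x. 0 \<le> g x"
    and meas_h [measurable]: "h \<in> borel_measurable borel" and h_nonneg: "\<And>y. 0 \<le> h y"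
    and a_pos: "0 < a" and aC: "a * C = \<kappa> / 8"
    and drift: "\<And>x. (\<integral>\<^sup>+ y. ennreal (h y) \<partial>L x) \<le> ennreal (g x / 4 + C)"
    and \<kappa>: "0 < \<kappa>" "\<kappa> \<le> 1"
    and sets_m: "sets m = sets borel" and mass_m: "ennreal \<kappa> \<le> emeasure m UNIV"
    and minorization: "\<And>x. g x \<le> 8 * C \<Longrightarrow> m \<le> L x"
begin

abbreviation "ga x \<equiv> 1/2 + a * g x"
abbreviation "ha y \<equiv> 1/2 + a * h y"
abbreviation "\<rho> \<equiv> 1 - \<kappa> / 4"

lemma C_pos: "0 < C"
proof -
  have "0 < a * C" using aC \<kappa> by simp
  then show ?thesis using a_pos by (simp add: zero_less_mult_iff)
qed

lemma a_g_nonneg: "0 \<le> a * g x" and a_h_nonneg: "0 \<le> a * h y"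
  using a_pos g_nonneg h_nonneg by (meson less_imp_le mult_nonneg_nonneg)+

lemma ga_nonneg: "0 \<le> ga x" and ha_nonneg: "0 \<le> ha y"
  using a_g_nonneg[of x] a_h_nonneg[of y] by linarith+

lemma meas_ga [measurable]: "ga \<in> borel_measurable borel"
  and meas_ha [measurable]: "ha \<in> borel_measurable borel"
  by measurable

lemma subprob_kernel: "L \<in> borel \<rightarrow>\<^sub>M subprob_algebra borel"
  by (rule measurable_prob_algebraD[OF kernel])

lemma prob_L: "prob_space (L x)" and sets_L [measurable_cong]: "sets (L x) = sets borel"
  using measurable_space[OF kernel, of x] by (auto simp: space_prob_algebra)

lemma integrable_h: "integrable (L x) h"
  using drift[of x] h_nonneg
  by (intro integrableI_nonneg) (auto simp: top_unique less_top[symmetric])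

lemma integral_h_le: "(LINT y|L x. h y) \<le> g x / 4 + C"
  using drift[of x] h_nonneg g_nonneg[of x] C_pos
  by (simp add: nn_integral_eq_integral[OF integrable_h] del: ennreal_plus)

lemma integrable_ha: "integrable (L x) ha"
proof -
  interpret prob_space "L x" by (rule prob_L)
  show ?thesis using integrable_h[of x] by simp
qed

lemma integral_ha: "(LINT y|L x. ha y) = 1/2 + a * (LINT y|L x. h y)"
proof -
  interpret prob_space "L x" by (rule prob_L)
  show ?thesis using integrable_h[of x] by (simp add: prob_space)
qed

text \<open>A crude form of the drift that gives up the factor 1/4; it serves for
  integrability.\<close>

lemma integral_ha_le: "(LINT y|L x. ha y) \<le> \<kappa> / 8 + ga x"
proof -
  have "a * (LINT y|L x. h y) \<le> a * (g x / 4 + C)"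
    using a_pos by (intro mult_left_mono integral_h_le) auto
  also have "\<dots> = a * g x / 4 + \<kappa> / 8" using aC by (simp add: distrib_left)
  finally show ?thesis
    using a_g_nonneg[of x] unfolding integral_ha by linarith
qed

text \<open>Two regimes: if \<open>g x + g x'\<close> is large, the drift alone yields the
  contraction; otherwise both points lie in the sublevel set, and the common part \<open>m\<close>
  of the two kernels cancels mass.\<close>

lemma oscillation:
  assumes [measurable]: "\<phi> \<in> borel_measurable borel" and le: "\<And>y. \<bar>\<phi> y\<bar> \<le> ha y"
  shows "(LINT y|L x. \<phi> y) - (LINT y|L x'. \<phi> y) \<le> \<rho> * (ga x + ga x')"
proof -
  define G where "G = g x + g x'"
  have int: "integrable (L z) \<phi>" for z
    using le a_h_nonneg
    by (intro Bochner_Integration.integrable_bound[OF integrable_ha])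
       (auto simp: abs_of_nonneg)
  have H: "a * (LINT y|L z. h y) \<le> a * (g z / 4 + C)" for z
    using a_pos by (intro mult_left_mono integral_h_le) auto
  have sumH: "a * (LINT y|L x. h y) + a * (LINT y|L x'. h y) \<le> a * G / 4 + 2 * (a * C)"
    using H[of x] H[of x'] by (simp add: G_def distrib_left add_divide_distrib)
  have up: "(LINT y|L x. ha y - \<phi> y) = (LINT y|L x. ha y) - (LINT y|L x. \<phi> y)"
    "(LINT y|L x'. ha y + \<phi> y) = (LINT y|L x'. ha y) + (LINT y|L x'. \<phi> y)"
    using int integrable_ha by (intro Bochner_Integration.integral_diff Bochner_Integration.integral_add; blast)+
  have nonneg: "0 \<le> ha y - \<phi> y" "0 \<le> ha y + \<phi> y" for y
    using le[of y] by (auto simp: abs_le_iff)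
  have aG: "0 \<le> a * G" using a_g_nonneg[of x] a_g_nonneg[of x'] by (simp add: G_def distrib_left)
  have ga: "\<rho> * (ga x + ga x') = \<rho> * (1 + a * G)"
    by (simp add: G_def distrib_left)
  show ?thesis
  proof (cases "8 * C \<le> G")
    case True
    \<comment> \<open>Since \<open>\<kappa> \<le> a * G\<close>, the drift constants
      \<open>2 * (a * C) = \<kappa> / 4\<close> fit into \<open>a * G / 4\<close>, giving
      \<open>1 + a * G / 2\<close>. The loss in \<open>\<rho> * (1 + a * G)\<close> is
      \<open>\<kappa> / 4 + \<kappa> * (a * G) / 4\<close>, also at most
      \<open>a * G / 2\<close>.\<close>
    have "\<kappa> \<le> a * G"
      using mult_left_mono[OF True less_imp_le[OF a_pos]] aC by linarith
    moreover have "0 \<le> (LINT y|L x. ha y - \<phi> y)" "0 \<le> (LINT y|L x'. ha y + \<phi> y)"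
      using nonneg by (auto intro!: integral_nonneg_AE)
    ultimately have "(LINT y|L x. \<phi> y) - (LINT y|L x'. \<phi> y) \<le> 1 + a * G / 2"
      using up sumH aC by (simp only: integral_ha)
    also have "\<dots> \<le> \<rho> * (1 + a * G)"
    proof -
      have "\<kappa> * (a * G) \<le> 1 * (a * G)" using \<kappa> aG by (intro mult_right_mono) auto
      moreover have "\<rho> * (1 + a * G) = 1 + a * G - \<kappa> / 4 - \<kappa> * (a * G) / 4"
        by (simp add: algebra_simps)
      ultimately show ?thesis using \<open>\<kappa> \<le> a * G\<close> by linarith
    qed
    finally show ?thesis unfolding ga .
  next
    case False
    then have m: "m \<le> L x" "m \<le> L x'"
      using g_nonneg[of x] g_nonneg[of x'] by (auto simp: G_def intro!: minorization)
    have sm: "sets m = sets (L z)" for z by (simp add: sets_m sets_L)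
    note d = integral_mono_measure_nonneg[OF sm m(1) Bochner_Integration.integrable_diff[OF integrable_ha int] nonneg(1)]
    note s = integral_mono_measure_nonneg[OF sm m(2) Bochner_Integration.integrable_add[OF integrable_ha int] nonneg(2)]
    have fin: "emeasure m UNIV \<le> 1"
      using le_measureD3[OF m(1) sm, of UNIV] prob_space.emeasure_space_1[OF prob_L, of x]
        sets_eq_imp_space_eq[OF sets_L] by simp
    have "finite_measure m"
      using fin by (intro finite_measureI) (auto simp: sets_eq_imp_space_eq[OF sets_m] top_unique)
    then interpret m: finite_measure m .
    \<comment> \<open>Here the constant 1/2 in the weights pays: the nonnegative functions
      \<open>ha y - \<phi> y\<close> and \<open>ha y + \<phi> y\<close> sum to at least 1, and
      \<open>m\<close> lies below both kernels, so their integrals together are at least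
      \<open>\<kappa>\<close>.\<close>
    have "\<kappa> \<le> measure m UNIV"
      using mass_m by (simp add: m.emeasure_eq_measure)
    also have "\<dots> = (LINT y|m. 1)" by (simp add: sets_eq_imp_space_eq[OF sets_m])
    also have "\<dots> \<le> (LINT y|m. (ha y - \<phi> y) + (ha y + \<phi> y))"
      by (rule integral_mono[OF _ Bochner_Integration.integrable_add[OF d(1) s(1)]])
         (auto simp: a_h_nonneg)
    also have "\<dots> = (LINT y|m. ha y - \<phi> y) + (LINT y|m. ha y + \<phi> y)"
      by (rule Bochner_Integration.integral_add[OF d(1) s(1)])
    also have "\<dots> \<le> (LINT y|L x. ha y - \<phi> y) + (LINT y|L x'. ha y + \<phi> y)"
      using d(2) s(2) by simp
    finally have "(LINT y|L x. \<phi> y) - (LINT y|L x'. \<phi> y) \<le> 1 + (a * G / 4 + 2 * (a * C)) - \<kappa>"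
      using up sumH by (simp only: integral_ha)
    also have "\<dots> \<le> 1 - \<kappa> / 2"
    proof -
      \<comment> \<open>Now \<open>a * G / 4\<close> and \<open>2 * (a * C)\<close> are at most
        \<open>\<kappa> / 4\<close> each, so half of the gain \<open>\<kappa>\<close>
        remains.\<close>
      have "a * G \<le> a * (8 * C)"
        using False a_pos by (intro mult_left_mono) auto
      then show ?thesis using aC by linarith
    qed
    also have "\<dots> \<le> \<rho> * (1 + a * G)"
    proof -
      have "0 \<le> \<rho> * (a * G)"
        by (rule mult_nonneg_nonneg[OF _ aG]) (use \<kappa> in auto)
      then show ?thesis using \<kappa> by (simp add: algebra_simps)
    qed
    finally show ?thesis unfolding ga .
  qed
qed

text \<open>The drift keeps the image measure in the weighted class, so the dual description of the
  norm is available on the target space too.\<close>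

lemma Prob_weighted_bind:
  assumes M: "M \<in> Prob_weighted ga"
  shows "M \<bind> L \<in> Prob_weighted ha"
proof -
  have p: "prob_space M" "sets M = sets borel" and fin: "(\<integral>\<^sup>+ x. ennreal (ga x) \<partial>M) < \<infinity>"
    using M by (auto simp: Prob_weighted_def)
  have Ms: "M \<in> space (prob_algebra borel)" using p by (simp add: space_prob_algebra)
  have L: "L \<in> M \<rightarrow>\<^sub>M subprob_algebra borel"
    using subprob_kernel by (simp add: measurable_cong_sets[OF p(2) refl])
  interpret prob_space M by fact
  have [measurable]: "ga \<in> borel_measurable M" by (simp add: measurable_cong_sets[OF p(2) refl])
  have "(\<integral>\<^sup>+ y. ennreal (ha y) \<partial>(M \<bind> L)) = (\<integral>\<^sup>+ x. \<integral>\<^sup>+ y. ennreal (ha y) \<partial>L x \<partial>M)"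
    by (rule nn_integral_bind[OF _ L]) simp
  also have "\<dots> \<le> (\<integral>\<^sup>+ x. ennreal (\<kappa> / 8) + ennreal (ga x) \<partial>M)"
  proof (rule nn_integral_mono)
    fix x
    have "(\<integral>\<^sup>+ y. ennreal (ha y) \<partial>L x) = ennreal (LINT y|L x. ha y)"
      using a_h_nonneg by (intro nn_integral_eq_integral integrable_ha) auto
    also have "\<dots> \<le> ennreal (\<kappa> / 8 + ga x)"
      by (rule ennreal_leI[OF integral_ha_le])
    also have "\<dots> = ennreal (\<kappa> / 8) + ennreal (ga x)"
      using \<kappa> a_g_nonneg[of x] by (intro ennreal_plus) auto
    finally show "(\<integral>\<^sup>+ y. ennreal (ha y) \<partial>L x) \<le> ennreal (\<kappa> / 8) + ennreal (ga x)" .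
  qed
  also have "\<dots> = ennreal (\<kappa> / 8) + (\<integral>\<^sup>+ x. ennreal (ga x) \<partial>M)"
    by (subst nn_integral_add) (auto simp: emeasure_space_1)
  also have "\<dots> < \<infinity>"
    using fin by (simp add: less_top ennreal_add_eq_top)
  finally have "(\<integral>\<^sup>+ y. ennreal (ha y) \<partial>(M \<bind> L)) < \<infinity>" .
  moreover have "prob_space (M \<bind> L)" by (rule prob_space_bind'[OF Ms kernel])
  moreover have "sets (M \<bind> L) = sets borel"
    by (rule sets_bind) (use p sets_L sets_eq_imp_space_eq[OF p(2)] in auto)
  ultimately show ?thesis by (simp add: Prob_weighted_def)
qed

lemma integrable_weighted:
  assumes M: "M \<in> Prob_weighted f" and [measurable]: "f \<in> borel_measurable borel" and "\<And>x. 0 \<le> f x"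
  shows "integrable M f"
  using assms by (intro integrableI_nonneg) (auto simp: Prob_weighted_def cong: measurable_cong_sets)

text \<open>A signed \<open>s\<close> is written as \<open>(ha + s) - ha\<close>, a difference of
  two nonnegative functions that are integrable by the drift, and each is disintegrated
  separately.\<close>

lemma integral_bind_weighted:
  assumes M: "M \<in> Prob_weighted ga" and [measurable]: "s \<in> borel_measurable borel"
    and s: "\<And>y. \<bar>s y\<bar> \<le> ha y"
  shows "integrable M (\<lambda>x. LINT y|L x. s y)"
    "(LINT y|(M \<bind> L). s y) = (LINT x|M. LINT y|L x. s y)"
proof -
  interpret prob_space M using M by (simp add: Prob_weighted_def)
  have sM [measurable_cong]: "sets M = sets borel" using M by (simp add: Prob_weighted_def)
  have L: "L \<in> M \<rightarrow>\<^sub>M subprob_algebra borel"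
    using subprob_kernel by (simp add: measurable_cong_sets[OF sM refl])
  have meas: "(\<lambda>x. LINT y|L x. f y) \<in> borel_measurable M" if "f \<in> borel_measurable borel" for f :: "'b \<Rightarrow> real"
    by (rule measurable_compose[OF L integral_measurable_subprob_algebra[OF that]])
  have int_ga: "integrable M ga"
    by (rule integrable_weighted[OF M meas_ga ga_nonneg])
  have int_s: "integrable N s" if "integrable N ha" "sets N = sets borel" for N
    using s a_h_nonneg that
    by (intro Bochner_Integration.integrable_bound[OF that(1)])
       (auto simp: abs_of_nonneg measurable_cong_sets[OF that(2) refl])
  have le: "\<bar>LINT y|L x. s y\<bar> \<le> (LINT y|L x. ha y)" for x
  proof -
    have "\<bar>LINT y|L x. s y\<bar> \<le> (LINT y|L x. \<bar>s y\<bar>)" by (rule integral_abs_bound)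
    also have "\<dots> \<le> (LINT y|L x. ha y)"
      using s int_s[OF integrable_ha sets_L] by (intro integral_mono integrable_ha integrable_abs) auto
    finally show ?thesis .
  qed
  have le': "(LINT y|L x. ha y) \<le> \<kappa> / 8 + ga x" for x by (rule integral_ha_le)
  have i1: "integrable M (\<lambda>x. LINT y|L x. ha y)"
  proof (rule Bochner_Integration.integrable_bound)
    show "integrable M (\<lambda>x. \<kappa> / 8 + ga x)"
      by (intro Bochner_Integration.integrable_add integrable_const int_ga)
    show "AE x in M. norm (LINT y|L x. ha y) \<le> norm (\<kappa> / 8 + ga x)"
    proof (rule AE_I2)
      fix x show "norm (LINT y|L x. ha y) \<le> norm (\<kappa> / 8 + ga x)"
        using le[of x] le'[of x] unfolding real_norm_def by linarith
    qed
  qed (auto intro!: meas)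
  show i2: "integrable M (\<lambda>x. LINT y|L x. s y)"
  proof (rule Bochner_Integration.integrable_bound[OF i1 meas])
    show "AE x in M. norm (LINT y|L x. s y) \<le> norm (LINT y|L x. ha y)"
    proof (rule AE_I2)
      fix x show "norm (LINT y|L x. s y) \<le> norm (LINT y|L x. ha y)"
        using le[of x] unfolding real_norm_def by linarith
    qed
  qed simp
  have B: "M \<bind> L \<in> Prob_weighted ha" by (rule Prob_weighted_bind[OF M])
  have int_B: "integrable (M \<bind> L) ha"
    by (rule integrable_weighted[OF B meas_ha ha_nonneg])
  have int_sB: "integrable (M \<bind> L) s"
    using B by (intro int_s[OF int_B]) (simp add: Prob_weighted_def)
  have nonneg: "0 \<le> ha y" "0 \<le> ha y + s y" for y
    using s[of y] a_h_nonneg[of y] by linarith+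
  have "(LINT y|(M \<bind> L). s y) = (LINT y|(M \<bind> L). ha y + s y) - (LINT y|(M \<bind> L). ha y)"
    by (subst Bochner_Integration.integral_add[OF int_B int_sB]) (rule add_diff_cancel_left'[symmetric])
  also have "\<dots> = (LINT x|M. LINT y|L x. ha y + s y) - (LINT x|M. LINT y|L x. ha y)"
    by (subst (1 2) integral_bind_nonneg[OF _ L])
      (use not_empty nonneg integrable_ha int_s[OF integrable_ha sets_L] in
        \<open>auto intro!: Bochner_Integration.integrable_add[OF integrable_ha]\<close>)
  also have "(\<lambda>x. LINT y|L x. ha y + s y) = (\<lambda>x. (LINT y|L x. ha y) + (LINT y|L x. s y))"
    by (intro ext Bochner_Integration.integral_add integrable_ha int_s[OF integrable_ha sets_L])
  also have "(LINT x|M. (LINT y|L x. ha y) + (LINT y|L x. s y)) - (LINT x|M. LINT y|L x. ha y)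
      = (LINT x|M. LINT y|L x. s y)"
    by (subst Bochner_Integration.integral_add[OF i1 i2]) (rule add_diff_cancel_left')
  finally show "(LINT y|(M \<bind> L). s y) = (LINT x|M. LINT y|L x. s y)" .
qed

text \<open>Duality used twice: an extremal \<open>s\<close> for the target norm is pulled back to
  \<open>F\<close>, whose small oscillation makes it, up to a constant, a test function for the
  source norm with factor \<open>\<rho>\<close>.\<close>

theorem lip_le: "lip ga ha L \<le> ennreal \<rho>"
  unfolding lip_def
proof (rule SUP_least, clarify)
  fix M1 M2 :: "'a measure" assume M: "M1 \<in> Prob_weighted ga" "M2 \<in> Prob_weighted ga"
  obtain t where t: "0 \<le> t" "weighted_tv_norm ga (\<lambda>A. measure M1 A - measure M2 A) = ennreal t"
    and test: "\<And>F b. \<lbrakk>F \<in> borel_measurable borel; \<And>x. \<bar>F x\<bar> \<le> b * ga x\<rbrakk>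
      \<Longrightarrow> (LINT x|M1. F x) - (LINT x|M2. F x) \<le> b * t"
    using weighted_tv_norm_dual[OF M meas_ga ga_nonneg] by (smt (verit))
  obtain t' s where t': "weighted_tv_norm ha (\<lambda>A. measure (M1 \<bind> L) A - measure (M2 \<bind> L) A) = ennreal t'"
    and [measurable]: "s \<in> borel_measurable borel" and s: "\<And>y. \<bar>s y\<bar> = ha y"
    and s_t': "(LINT y|(M1 \<bind> L). s y) - (LINT y|(M2 \<bind> L). s y) = t'"
    using weighted_tv_norm_dual[OF M[THEN Prob_weighted_bind] meas_ha ha_nonneg] by (smt (verit))
  define F where "F x = (LINT y|L x. s y)" for x
  have s_le: "\<bar>s y\<bar> \<le> ha y" for y using s by simp
  have meas_F [measurable]: "F \<in> borel_measurable borel"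
    unfolding F_def by (rule measurable_compose[OF subprob_kernel integral_measurable_subprob_algebra]) simp
  obtain b where b: "\<bar>F x - b\<bar> \<le> \<rho> * ga x" for x
    using weighted_oscillation[of F \<rho> ga] oscillation[of s] s_le unfolding F_def by auto
  have int_F: "integrable N F" "(LINT x|N. F x - b) = (LINT x|N. F x) - b"
    if "N \<in> Prob_weighted ga" for N
  proof -
    interpret prob_space N using that by (simp add: Prob_weighted_def)
    show i: "integrable N F"
      unfolding F_def using s_le by (intro integral_bind_weighted[OF that]) auto
    show "(LINT x|N. F x - b) = (LINT x|N. F x) - b"
      using i by (simp add: prob_space)
  qed
  have "t' = (LINT x|M1. F x) - (LINT x|M2. F x)"
    unfolding s_t'[symmetric] F_def using s_le by (simp add: integral_bind_weighted(2) M)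
  \<comment> \<open>The constant \<open>b\<close> cancels because both measures have mass
    one.\<close>
  also have "\<dots> = (LINT x|M1. F x - b) - (LINT x|M2. F x - b)"
    using M by (simp add: int_F)
  also have "\<dots> \<le> \<rho> * t"
    by (rule test[OF _ b]) simp
  finally have "ennreal t' \<le> ennreal \<rho> * ennreal t"
    using \<kappa> t(1) by (simp add: ennreal_leI flip: ennreal_mult)
  then show "weighted_tv_norm ha (\<lambda>A. measure (M1 \<bind> L) A - measure (M2 \<bind> L) A)
      / weighted_tv_norm ga (\<lambda>A. measure M1 A - measure M2 A) \<le> ennreal \<rho>"
    \<comment> \<open>For \<open>t = 0\<close> the estimate forces the numerator to vanish, and
      \<open>0 / 0 = 0\<close> in \<open>ennreal\<close>.\<close>
    unfolding t t' by (cases "t = 0") (auto simp: divide_le_posI_ennreal t(1) less_le mult.commute)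
qed
end

section \<open>Kernels bounded by Gibbs weights\<close>

lemma measurable_density_kernel:
  fixes k :: "'a::topological_space \<Rightarrow> 'b::topological_space \<Rightarrow> real"
  assumes M: "sigma_finite_measure M" "sets M = sets borel"
    and k [measurable]: "case_prod k \<in> borel_measurable (borel \<Otimes>\<^sub>M borel)"
    and one: "\<And>x. (\<integral>\<^sup>+ y. ennreal (k x y) \<partial>M) = 1"
  shows "(\<lambda>x. density M (\<lambda>y. ennreal (k x y))) \<in> borel \<rightarrow>\<^sub>M prob_algebra borel"
proof -
  interpret sigma_finite_measure M by fact
  note [measurable_cong] = M(2)
  have p: "prob_space (density M (\<lambda>y. ennreal (k x y)))" for x
    using one[of x] sets_eq_imp_space_eq[OF M(2)]
    by (intro prob_spaceI) (simp add: emeasure_density cong: nn_integral_cong_simp)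
  show ?thesis
  proof (intro measurable_prob_algebraI measurable_subprob_algebra p prob_space_imp_subprob_space[OF p])
    fix A :: "'b set" assume [measurable]: "A \<in> sets borel"
    have "(\<lambda>x. \<integral>\<^sup>+ y. ennreal (k x y) * indicator A y \<partial>M) \<in> borel_measurable borel"
      by measurable
    then show "(\<lambda>x. emeasure (density M (\<lambda>y. ennreal (k x y))) A) \<in> borel_measurable borel"
      by (subst emeasure_density) (auto simp: M(2))
  qed (simp add: M(2))
qed

text \<open>What condition (A) provides, freed from topology: the exponentials of the averaged costs
  are bounded by multiples of the weights and small relative to them up to a constant, the weights
  are square integrable, and \<open>W\<close> is bounded above on products of sublevel sets.\<close>

locale weighted_cost_pair = cost_pair mu eta W c
  for mu :: "'x::topological_space measure" and eta :: "'y::topological_space measure" and W c +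
  fixes g :: "'x \<Rightarrow> real" and h :: "'y \<Rightarrow> real"
  assumes meas_g [measurable]: "g \<in> borel_measurable borel" and g_pos: "\<And>x. 0 < g x"
    and meas_h [measurable]: "h \<in> borel_measurable borel" and h_pos: "\<And>y. 0 < h y"
    and int_g2: "integrable mu (\<lambda>x. (g x)\<^sup>2)" and int_h2: "integrable eta (\<lambda>y. (h y)\<^sup>2)"
    and P_le: "\<exists>T. \<forall>x. exp (LINT y|eta. W x y) \<le> T * g x"
    and Q_le: "\<exists>T. \<forall>y. exp (LINT x|mu. W x y) \<le> T * h y"
    and P_small: "\<And>\<epsilon>. 0 < \<epsilon> \<Longrightarrow> \<exists>C. \<forall>x. exp (LINT y|eta. W x y) \<le> \<epsilon> * g x + C"
    and Q_small: "\<And>\<epsilon>. 0 < \<epsilon> \<Longrightarrow> \<exists>C. \<forall>y. exp (LINT x|mu. W x y) \<le> \<epsilon> * h y + C"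
    and W_bounded: "\<And>r. \<exists>w. \<forall>x y. g x \<le> r \<longrightarrow> h y \<le> r \<longrightarrow> W x y \<le> w"
begin

lemma weighted_dual: "weighted_cost_pair eta mu (\<lambda>y x. W x y) c h g"
  using W_bounded
  by (intro weighted_cost_pair.intro dual weighted_cost_pair_axioms.intro)
     (auto simp: g_pos h_pos int_g2 int_h2 P_le Q_le P_small Q_small, metis)

lemma integrable_g: "integrable mu g"
proof (rule Bochner_Integration.integrable_bound)
  show "integrable mu (\<lambda>x. 1 + (g x)\<^sup>2)" using int_g2 by simp
  have "\<bar>g x\<bar> \<le> 1 + (g x)\<^sup>2" for x
    using g_pos[of x] sum_squares_bound[of 1 "g x"] by simp
  then show "AE x in mu. norm (g x) \<le> norm (1 + (g x)\<^sup>2)" by simp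
qed simp

text \<open>\<open>Q\<close> is at most a multiple of \<open>h\<close>, so the square integrability
  of \<open>h\<close> suffices.\<close>

lemma integrable_Q_h: "integrable eta (\<lambda>y. Q y * h y)"
proof -
  obtain T where T: "\<And>y. Q y \<le> T * h y" using Q_le by auto
  have "norm (Q y * h y) \<le> norm (\<bar>T\<bar> * (h y)\<^sup>2)" for y
  proof -
    have "Q y \<le> \<bar>T\<bar> * h y"
      using T[of y] mult_right_mono[OF abs_ge_self[of T], of "h y"] h_pos[of y] by linarith
    then show ?thesis
      using h_pos[of y] by (simp add: abs_mult power2_eq_square)
  qed
  then show ?thesis
    by (intro Bochner_Integration.integrable_bound[OF integrable_mult_right[OF int_h2, of "\<bar>T\<bar>"]]) auto
qed

text \<open>The constant \<open>D\<close> is a parameter so that later constants can be chosen from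
  \<open>D\<close> before \<open>k\<close>, hence uniformly over all Sinkhorn transitions.\<close>

definition gibbs_kernel :: "real \<Rightarrow> ('x \<Rightarrow> 'y \<Rightarrow> real) \<Rightarrow> bool" where
  "gibbs_kernel D k \<longleftrightarrow> case_prod k \<in> borel_measurable (borel \<Otimes>\<^sub>M borel)
     \<and> (\<forall>x. (\<integral>\<^sup>+ y. ennreal (k x y) \<partial>eta) = 1)
     \<and> (\<forall>x y. k x y \<le> D * P x * Q y) \<and> (\<forall>x y. exp (- W x y) \<le> D * k x y)"

definition kernel_measure :: "('x \<Rightarrow> 'y \<Rightarrow> real) \<Rightarrow> 'x \<Rightarrow> 'y measure" where
  "kernel_measure k x = density eta (\<lambda>y. ennreal (k x y))"

lemma measurable_kernel_measure:
  "gibbs_kernel D k \<Longrightarrow> kernel_measure k \<in> borel \<rightarrow>\<^sub>M prob_algebra borel"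
  unfolding kernel_measure_def[abs_def]
  by (rule measurable_density_kernel[OF eta.sigma_finite_measure_axioms sets_eta])
     (auto simp: gibbs_kernel_def)

section \<open>Drift and minorization from the two density bounds\<close>

lemma kernel_measure_h_le:
  assumes k: "gibbs_kernel D k" and D: "0 < D"
  shows "(\<integral>\<^sup>+ y. ennreal (h y) \<partial>kernel_measure k x) \<le> ennreal (D * (LINT y|eta. Q y * h y) * P x)"
proof -
  have [measurable]: "case_prod k \<in> borel_measurable (borel \<Otimes>\<^sub>M borel)"
    and le: "\<And>y. k x y \<le> D * P x * Q y"
    using k by (auto simp: gibbs_kernel_def)
  have "(\<integral>\<^sup>+ y. ennreal (h y) \<partial>kernel_measure k x) = (\<integral>\<^sup>+ y. ennreal (k x y) * ennreal (h y) \<partial>eta)"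
    unfolding kernel_measure_def by (subst nn_integral_density) auto
  also have "\<dots> \<le> (\<integral>\<^sup>+ y. ennreal (D * P x * (Q y * h y)) \<partial>eta)"
  proof (rule nn_integral_mono)
    fix y
    have "ennreal (k x y) * ennreal (h y) \<le> ennreal (D * P x * Q y) * ennreal (h y)"
      by (intro mult_right_mono ennreal_leI le) auto
    then show "ennreal (k x y) * ennreal (h y) \<le> ennreal (D * P x * (Q y * h y))"
      using D h_pos[of y] by (simp add: mult.assoc flip: ennreal_mult)
  qed
  also have "\<dots> = ennreal (LINT y|eta. D * P x * (Q y * h y))"
    using D h_pos by (intro nn_integral_eq_integral integrable_mult_right integrable_Q_h) (auto simp: less_imp_le)
  also have "(LINT y|eta. D * P x * (Q y * h y)) = D * (LINT y|eta. Q y * h y) * P x"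
    by (subst integral_mult_right_zero) simp
  finally show ?thesis .
qed

lemma integral_Q_h_nonneg: "0 \<le> (LINT y|eta. Q y * h y)"
  using h_pos by (intro integral_nonneg_AE) (auto simp: less_imp_le)

lemma kernel_measure_h_le_g:
  assumes D: "0 < D"
  obtains T where "0 \<le> T"
    "\<And>k x. gibbs_kernel D k \<Longrightarrow> (\<integral>\<^sup>+ y. ennreal (h y) \<partial>kernel_measure k x) \<le> ennreal (T * g x)"
proof -
  obtain T where T: "\<And>x. P x \<le> T * g x" using P_le by auto
  have "0 < T" using less_le_trans[OF exp_gt_zero T] g_pos by (metis zero_less_mult_pos2)
  show ?thesis
  proof
    show "0 \<le> D * (LINT y|eta. Q y * h y) * T"
      using D \<open>0 < T\<close> integral_Q_h_nonneg by simp
    fix k x assume k: "gibbs_kernel D k"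
    have "D * (LINT y|eta. Q y * h y) * P x \<le> D * (LINT y|eta. Q y * h y) * (T * g x)"
      using D integral_Q_h_nonneg by (intro mult_left_mono T) auto
    then show "(\<integral>\<^sup>+ y. ennreal (h y) \<partial>kernel_measure k x)
        \<le> ennreal (D * (LINT y|eta. Q y * h y) * T * g x)"
      using order_trans[OF kernel_measure_h_le[OF k D] ennreal_leI] by (simp add: mult.assoc)
  qed
qed

text \<open>Integrating \<open>h\<close> costs a multiple of \<open>P x\<close>; smallness of
  \<open>P\<close> relative to \<open>g\<close> brings that multiple down to \<open>g x / 4\<close>,
  up to a constant.\<close>

lemma kernel_measure_drift:
  assumes D: "0 < D"
  obtains C where "\<And>k x. gibbs_kernel D k
    \<Longrightarrow> (\<integral>\<^sup>+ y. ennreal (h y) \<partial>kernel_measure k x) \<le> ennreal (g x / 4 + C)"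
proof -
  define S where "S = D * (LINT y|eta. Q y * h y)"
  have S: "0 \<le> S" using D integral_Q_h_nonneg by (simp add: S_def)
  \<comment> \<open>This \<open>\<epsilon>\<close> makes \<open>S * \<epsilon> \<le> 1/4\<close>;
    the summand 1 guards against \<open>S = 0\<close>.\<close>
  obtain C where C: "\<And>x. P x \<le> 1 / (4 * (S + 1)) * g x + C"
    using P_small[of "1 / (4 * (S + 1))"] S by auto
  show ?thesis
  proof
    fix k x assume k: "gibbs_kernel D k"
    have "S * P x \<le> S * (1 / (4 * (S + 1)) * g x + C)"
      using S C by (intro mult_left_mono)
    also have "\<dots> = S / (S + 1) * (g x / 4) + S * C"
      using S by (simp add: field_simps)
    also have "\<dots> \<le> 1 * (g x / 4) + S * C"
      using S g_pos[of x] by (intro add_right_mono mult_right_mono) auto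
    finally show "(\<integral>\<^sup>+ y. ennreal (h y) \<partial>kernel_measure k x) \<le> ennreal (g x / 4 + S * C)"
      using order_trans[OF kernel_measure_h_le[OF k D] ennreal_leI] by (simp add: S_def)
  qed
qed

text \<open>\<open>W\<close> is bounded on products of sublevel sets, so the density has a positive
  lower bound there, and a multiple of \<open>eta\<close> restricted to a sublevel set of
  \<open>h\<close> lies below every kernel.\<close>

lemma kernel_measure_minorization:
  assumes D: "0 < D"
  obtains \<kappa> m where "0 < \<kappa>" "sets m = sets borel" "ennreal \<kappa> \<le> emeasure m UNIV"
    "\<And>k x. \<lbrakk>gibbs_kernel D k; g x \<le> r\<rbrakk> \<Longrightarrow> m \<le> kernel_measure k x"
proof -
  \<comment> \<open>The sublevel sets of \<open>h\<close> exhaust the space, so one of them has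
    positive \<open>eta\<close>-mass.\<close>
  have "(\<Union>i::nat. {y. h y \<le> real i}) = space eta"
    using real_arch_simple by (auto simp: space_eta)
  moreover have "{y. h y \<le> real i} \<in> sets eta" for i :: nat
    by (simp add: sets_eta)
  ultimately have "\<exists>i::nat. emeasure eta {y. h y \<le> real i} \<noteq> 0"
    using emeasure_UN_eq_0[of eta "\<lambda>i::nat. {y. h y \<le> real i}"] eta.emeasure_space_1
    by (metis (no_types, lifting) image_subsetI zero_neq_one)
  then obtain i :: nat where i: "emeasure eta {y. h y \<le> real i} \<noteq> 0" ..
  define B where "B = {y. h y \<le> real i}"
  have [measurable]: "B \<in> sets borel" by (simp add: B_def)
  \<comment> \<open>\<open>W_bounded\<close> uses one level for both weights, hence the
    maximum.\<close>
  obtain w where w: "\<And>x y. g x \<le> max r (real i) \<Longrightarrow> h y \<le> max r (real i) \<Longrightarrow> W x y \<le> w"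
    using W_bounded by metis
  define e where "e = exp (- w) / D"
  define m where "m = density eta (\<lambda>y. ennreal e * indicator B y)"
  have e: "0 < e" using D by (simp add: e_def)
  have em: "emeasure m UNIV = ennreal (e * measure eta B)"
    unfolding m_def using e
    by (subst emeasure_density)
      (auto simp: sets_eta nn_integral_cmult eta.emeasure_eq_measure ennreal_mult)
  show ?thesis
  proof
    show "sets m = sets borel" by (simp add: m_def sets_eta)
    show "0 < e * measure eta B"
      using e i by (simp add: B_def eta.emeasure_eq_measure zero_less_measure_iff)
    show "ennreal (e * measure eta B) \<le> emeasure m UNIV" by (simp add: em)
    fix k x assume k: "gibbs_kernel D k" and x: "g x \<le> r"
    have [measurable]: "case_prod k \<in> borel_measurable (borel \<Otimes>\<^sub>M borel)"
      and le: "\<And>y. exp (- W x y) \<le> D * k x y"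
      using k by (auto simp: gibbs_kernel_def)
    have *: "ennreal e * indicator B y \<le> ennreal (k x y)" for y
    proof (cases "y \<in> B")
      case True
      then have "exp (- w) \<le> exp (- W x y)" using w[of x y] x by (auto simp: B_def)
      also note le
      finally have "e \<le> k x y" using D by (simp add: e_def field_simps)
      then show ?thesis using True by (simp add: ennreal_leI)
    qed simp
    have "emeasure m A \<le> emeasure (kernel_measure k x) A" for A
    proof (cases "A \<in> sets eta")
      case True
      then show ?thesis
        unfolding m_def kernel_measure_def
        by (subst (1 2) emeasure_density) (auto intro!: nn_integral_mono mult_right_mono *)
    next
      case False
      then show ?thesis by (simp add: m_def emeasure_notin_sets)
    qed
    then show "m \<le> kernel_measure k x"
      by (simp add: le_measure_iff le_fun_def m_def kernel_measure_def)
  qed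
qed

text \<open>The first family consists of the densities with respect to \<open>eta\<close> of the
  transitions with index \<open>2 * Suc n\<close>, the second of those with respect to
  \<open>mu\<close> for index \<open>2 * Suc n + 1\<close>. One \<open>D\<close> serves
  both.\<close>

lemma gibbs_kernel_potentials:
  obtains D where "0 < D"
    "\<And>n. gibbs_kernel D (\<lambda>x y. exp (- W x y - copot n y - pot (Suc n) x))"
    "\<And>n. weighted_cost_pair.gibbs_kernel eta mu (\<lambda>y x. W x y) D
      (\<lambda>y x. exp (- W x y - pot (Suc n) x - copot (Suc n) y))"
proof -
  interpret D: weighted_cost_pair eta mu "\<lambda>y x. W x y" c h g by (rule weighted_dual)
  \<comment> \<open>The first entry is for the upper density bound; the second bounds
    \<open>exp (copot n y) * exp (pot (Suc j) x)\<close> for the lower one.\<close>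
  define D where "D = max (c\<^sup>2) ((c\<^sup>2 * (LINT x|mu. P x)) * (c * (LINT y|eta. Q y)))"
  have D: "0 < D" using c_pos by (simp add: D_def less_max_iff_disj)
  have u [measurable]: "pot n \<in> borel_measurable borel" for n
    by (rule meas_u[OF admissible_potential])
  have v [measurable]: "copot n \<in> borel_measurable borel" for n
    by (rule D.meas_u[OF admissible_copotential])
  have upper: "exp (- W x y - copot n y - pot j x) \<le> D * P x * Q y" for x y n j
  proof -
    have "exp (- W x y) * exp (- copot n y) * exp (- pot j x) \<le> c * Q y * (c * P x)"
      using c_pos
      by (intro mult_mono exp_W_le exp_minus_copotential_le exp_minus_potential_le) auto
    also have "\<dots> = c\<^sup>2 * P x * Q y" by (simp add: power2_eq_square)
    also have "\<dots> \<le> D * P x * Q y" by (intro mult_right_mono) (auto simp: D_def)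
    finally show ?thesis by (simp add: exp_diff exp_minus divide_inverse)
  qed
  have lower: "exp (- W x y) \<le> D * exp (- W x y - copot n y - pot (Suc j) x)" for x y n j
  proof -
    have "exp (copot n y) * exp (pot (Suc j) x)
        \<le> (c\<^sup>2 * (LINT x|mu. P x)) * (c * (LINT y|eta. Q y))"
      by (rule mult_mono'[OF exp_copotential_le exp_potential_Suc_le]) auto
    also have "\<dots> \<le> D" by (simp add: D_def)
    finally have "exp (copot n y) * exp (pot (Suc j) x) * exp (- W x y - copot n y - pot (Suc j) x)
        \<le> D * exp (- W x y - copot n y - pot (Suc j) x)"
      by (rule mult_right_mono) auto
    then show ?thesis by (simp flip: exp_add)
  qed
  show ?thesis
  proof
    \<comment> \<open>Both total masses are one because \<open>pot (Suc n)\<close> is the transform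
      of \<open>copot n\<close>, and \<open>copot (Suc n)\<close> that of
      \<open>pot (Suc n)\<close>.\<close>
    fix n
    have "(\<integral>\<^sup>+ y. ennreal (exp (- W x y - copot n y - pot (Suc n) x)) \<partial>eta) = 1" for x
    proof -
      have "(\<integral>\<^sup>+ y. ennreal (exp (- W x y - copot n y - pot (Suc n) x)) \<partial>eta)
          = (\<integral>\<^sup>+ y. ennreal (exp (- pot (Suc n) x)) * ennreal (exp (- W x y) * exp (- copot n y)) \<partial>eta)"
        by (intro nn_integral_cong) (simp add: exp_diff exp_minus divide_inverse flip: ennreal_mult)
      also have "\<dots> = ennreal (exp (- pot (Suc n) x)) * ennreal (exp (pot (Suc n) x))"
        using D.integrable_kernel[OF admissible_copotential[of n], of x]
        by (simp add: nn_integral_cmult nn_integral_eq_integral D.exp_log_transform[OF admissible_copotential])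
      finally show ?thesis by (simp flip: ennreal_mult exp_add)
    qed
    then show "gibbs_kernel D (\<lambda>x y. exp (- W x y - copot n y - pot (Suc n) x))"
      unfolding gibbs_kernel_def by (intro conjI allI upper lower) measurable
    have "(\<integral>\<^sup>+ x. ennreal (exp (- W x y - pot (Suc n) x - copot (Suc n) y)) \<partial>mu) = 1" for y
    proof -
      have "(\<integral>\<^sup>+ x. ennreal (exp (- W x y - pot (Suc n) x - copot (Suc n) y)) \<partial>mu)
          = (\<integral>\<^sup>+ x. ennreal (exp (- copot (Suc n) y)) * ennreal (exp (- W x y) * exp (- pot (Suc n) x)) \<partial>mu)"
        by (intro nn_integral_cong) (simp add: exp_diff exp_minus divide_inverse flip: ennreal_mult)
      also have "\<dots> = ennreal (exp (- copot (Suc n) y)) * ennreal (exp (copot (Suc n) y))"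
        using integrable_kernel[OF admissible_potential[of "Suc n"], of y]
        by (simp add: nn_integral_cmult nn_integral_eq_integral exp_log_transform[OF admissible_potential] del: potential.simps)
      finally show ?thesis by (simp flip: ennreal_mult exp_add)
    qed
    then show "D.gibbs_kernel D (\<lambda>y x. exp (- W x y - pot (Suc n) x - copot (Suc n) y))"
      unfolding D.gibbs_kernel_def
    proof (intro conjI allI)
      fix x y
      have eq: "- W x y - pot (Suc n) x - copot (Suc n) y = - W x y - copot (Suc n) y - pot (Suc n) x"
        by (simp only: diff_right_commute)
      show "exp (- W x y - pot (Suc n) x - copot (Suc n) y) \<le> D * Q y * P x"
        using upper[of x y "Suc n" "Suc n"] unfolding eq by (simp only: ac_simps)
      show "exp (- W x y) \<le> D * exp (- W x y - pot (Suc n) x - copot (Suc n) y)"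
        unfolding eq by (rule lower)
    qed measurable
  qed (rule D)
qed

end

section \<open>Sinkhorn transitions\<close>

lemma locally_bounded_compact:
  assumes f: "locally_bounded f" and K: "compact K"
  obtains b where "\<And>x. x \<in> K \<Longrightarrow> \<bar>f x\<bar> \<le> b"
proof -
  obtain S where S: "\<And>x. open (S x)" "\<And>x. x \<in> S x" "\<And>x. bounded (f ` S x)"
    using f unfolding locally_bounded_def by metis
  have "K \<subseteq> (\<Union>x\<in>K. S x)" using S(2) by auto
  then obtain A where A: "A \<subseteq> K" "finite A" "K \<subseteq> (\<Union>x\<in>A. S x)"
    using compactE_image[OF K, of K S] S(1) by metis
  have "bounded (\<Union>x\<in>A. f ` S x)"
    using A(2) S(3) by (intro bounded_UN) auto
  then have "bounded (f ` K)"
    by (rule bounded_subset) (use A(3) in \<open>unfold image_UN[symmetric], rule image_mono\<close>)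
  then show ?thesis
    using that by (auto simp: bounded_iff)
qed

text \<open>The first bound uses only that \<open>\<theta>\<close> is bounded. For the second,
  \<open>\<theta>\<close> is below \<open>\<epsilon>\<close> off a compact set, and on that set
  \<open>V\<close> is bounded.\<close>

lemma vanishing_bound:
  fixes f \<theta> V :: "'a::topological_space \<Rightarrow> real"
  assumes \<theta>: "\<theta> \<in> B0" and le: "\<And>x. f x \<le> \<theta> x * exp (\<delta> * V x)"
    and V: "locally_bounded V" and "0 < \<delta>"
  shows "\<exists>T. \<forall>x. f x \<le> T * exp (\<delta> * V x)"
    and "0 < \<epsilon> \<Longrightarrow> \<exists>C. \<forall>x. f x \<le> \<epsilon> * exp (\<delta> * V x) + C"
proof -
  define S where "S = (SUP x. \<theta> x)"
  have \<theta>_le: "\<theta> x \<le> S" for x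
    using \<theta> unfolding S_def B0_def by (auto intro: cSUP_upper)
  have pos: "0 < \<theta> x" for x using \<theta> by (simp add: B0_def)
  have S: "0 < S" using pos \<theta>_le less_le_trans by blast
  have f_le: "f x \<le> S * exp (\<delta> * V x)" for x
    by (rule order_trans[OF le mult_right_mono[OF \<theta>_le]]) simp
  then show "\<exists>T. \<forall>x. f x \<le> T * exp (\<delta> * V x)" by blast
  assume "0 < \<epsilon>"
  \<comment> \<open>Compactness in \<open>B0\<close> is available strictly below the supremum, hence
    the cap \<open>S / 2\<close>.\<close>
  define e where "e = min \<epsilon> (S / 2)"
  have "0 < e" "e < S" using S \<open>0 < \<epsilon>\<close> by (auto simp: e_def)
  then have "compact {x. e \<le> \<theta> x}"
    using \<theta> by (auto simp: B0_def S_def)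
  then obtain b where b: "\<And>x. e \<le> \<theta> x \<Longrightarrow> \<bar>V x\<bar> \<le> b"
    using locally_bounded_compact[OF V] by (metis mem_Collect_eq)
  have "f x \<le> \<epsilon> * exp (\<delta> * V x) + S * exp (\<delta> * b)" for x
  proof (cases "e \<le> \<theta> x")
    case True
    then have "exp (\<delta> * V x) \<le> exp (\<delta> * b)" using b[OF True] \<open>0 < \<delta>\<close> by simp
    then have "S * exp (\<delta> * V x) \<le> S * exp (\<delta> * b)" using S by simp
    then show ?thesis using f_le[of x] \<open>0 < \<epsilon>\<close> by (smt (verit) exp_gt_zero mult_pos_pos)
  next
    case False
    then have "\<theta> x * exp (\<delta> * V x) \<le> \<epsilon> * exp (\<delta> * V x)"
      by (intro mult_right_mono) (auto simp: e_def)
    moreover have "0 \<le> S * exp (\<delta> * b)" using S by simp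
    ultimately show ?thesis using le[of x] by linarith
  qed
  then show "\<exists>C. \<forall>x. f x \<le> \<epsilon> * exp (\<delta> * V x) + C" by blast
qed

lemma sublevel_exp:
  fixes \<delta> s :: real
  assumes "0 < \<delta>" "exp (\<delta> * s) \<le> r"
  shows "s \<le> ln r / \<delta>"
proof -
  have "0 < r" using less_le_trans[OF exp_gt_zero assms(2)] .
  then have "\<delta> * s \<le> ln r" using assms(2) by (simp add: ln_ge_iff)
  then show ?thesis using assms(1) by (simp add: field_simps)
qed

text \<open>The weights combine: \<open>exp (- U x)\<close> times
  \<open>exp (2 * \<delta> * U x)\<close> is the Gibbs weight of
  \<open>(1 - 2 * \<delta>) * U\<close>.\<close>

lemma gibbs_integrable_square:
  fixes lam :: "'a::topological_space measure"
  assumes [measurable_cong]: "sets lam = sets borel" and [measurable]: "U \<in> borel_measurable borel"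
    and fin: "emeasure (gibbs lam (\<lambda>x. (1 - 2 * \<delta>) * U x)) UNIV < \<infinity>"
  shows "integrable (gibbs lam U) (\<lambda>x. (exp (\<delta> * U x))\<^sup>2)"
proof -
  have "(\<integral>\<^sup>+ x. ennreal ((exp (\<delta> * U x))\<^sup>2) \<partial>gibbs lam U)
      = (\<integral>\<^sup>+ x. ennreal (exp (- U x)) * ennreal ((exp (\<delta> * U x))\<^sup>2) \<partial>lam)"
    unfolding gibbs_def by (subst nn_integral_density) auto
  also have "\<dots> = (\<integral>\<^sup>+ x. ennreal (exp (- ((1 - 2 * \<delta>) * U x))) * indicator UNIV x \<partial>lam)"
    by (intro nn_integral_cong)
       (simp add: power2_eq_square algebra_simps flip: ennreal_mult exp_add)
  also have "\<dots> = emeasure (gibbs lam (\<lambda>x. (1 - 2 * \<delta>) * U x)) UNIV"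
    unfolding gibbs_def by (subst emeasure_density) (auto simp: assms(1))
  finally show ?thesis
    using fin by (intro integrableI_nonneg) (auto simp: gibbs_def)
qed

section \<open>Condition (A) and the Sinkhorn iterates in centred form\<close>

context schroedinger_setting
begin

lemma condition_A_weighted_cost_pair:
  assumes A: "condition_A lam nu U V W \<delta>"
  obtains c where "weighted_cost_pair (gibbs lam U) (gibbs nu V) W c
    (\<lambda>x. exp (\<delta> * U x)) (\<lambda>y. exp (\<delta> * V y))"
proof -
  note [measurable_cong] = sets_lam sets_nu and [measurable] = measurable_U measurable_V measurable_W
  interpret mu: prob_space "gibbs lam U" by (rule prob_mu)
  interpret eta: prob_space "gibbs nu V" by (rule prob_eta)
  have sets [measurable_cong]: "sets (gibbs lam U) = sets borel" "sets (gibbs nu V) = sets borel"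
    by (simp_all add: gibbs_def sets_lam sets_nu)
  have \<delta>: "0 < \<delta>"
    and finU: "emeasure (gibbs lam (\<lambda>x. (1 - 2 * \<delta>) * U x)) UNIV < \<infinity>"
    and finV: "emeasure (gibbs nu (\<lambda>x. (1 - 2 * \<delta>) * V x)) UNIV < \<infinity>"
    and int_W: "\<And>x. integrable (gibbs nu V) (\<lambda>y. W x y)" "\<And>y. integrable (gibbs lam U) (\<lambda>x. W x y)"
    using A by (auto simp: condition_A_def)
  obtain \<theta>u \<theta>v where \<theta>: "\<theta>u \<in> B0" "\<theta>v \<in> B0"
    and \<theta>u: "\<And>x. exp (- U_delta nu U V W \<delta> x) \<le> \<theta>u x"
    and \<theta>v: "\<And>y. exp (- V_delta lam U V W \<delta> y) \<le> \<theta>v y"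
    using A by (auto simp: condition_A_def)
  obtain c where c: "\<And>x y. exp (- W x y) \<le> c" using bounded_exp_W by auto
  have P_\<theta>: "exp (LINT y|gibbs nu V. W x y) \<le> \<theta>u x * exp (\<delta> * U x)" for x
    using mult_right_mono[OF \<theta>u[of x], of "exp (\<delta> * U x)"]
    by (simp add: U_delta_def W_sup_def flip: exp_add)
  have Q_\<theta>: "exp (LINT x|gibbs lam U. W x y) \<le> \<theta>v y * exp (\<delta> * V y)" for y
    using mult_right_mono[OF \<theta>v[of y], of "exp (\<delta> * V y)"]
    by (simp add: V_delta_def W_sub_def flip: exp_add)
  note P = vanishing_bound[OF \<theta>(1) P_\<theta> locally_bounded_U \<delta>]
  note Q = vanishing_bound[OF \<theta>(2) Q_\<theta> locally_bounded_V \<delta>]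
  note sqU = gibbs_integrable_square[OF sets_lam measurable_U finU]
  note sqV = gibbs_integrable_square[OF sets_nu measurable_V finV]
  \<comment> \<open>Square integrability of the weight gives integrability of \<open>f\<close>,
    through \<open>T * k x \<le> T\<^sup>2 + (k x)\<^sup>2\<close> on a probability space.\<close>
  have bound: "integrable M f"
    if M: "prob_space M" "sets M = sets borel" and [measurable]: "f \<in> borel_measurable borel"
      and sq: "integrable M (\<lambda>x. (k x)\<^sup>2)" and f: "\<exists>T. \<forall>x. f x \<le> T * k x" "\<And>x. 0 \<le> f x"
    for M :: "'c::topological_space measure" and f k :: "'c \<Rightarrow> real"
  proof -
    interpret prob_space M by fact
    note [measurable_cong] = M(2)
    obtain T where T: "\<And>x. f x \<le> T * k x" using f by auto
    have "norm (f x) \<le> norm (T\<^sup>2 + (k x)\<^sup>2)" for x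
    proof -
      have "0 \<le> (T * T + k x * k x - 2 * (T * k x)) \<and> 0 \<le> T * T + k x * k x"
        using sum_squares_bound[of T "k x"] by (simp add: power2_eq_square)
      then have "f x \<le> T * T + k x * k x"
        using T[of x] f(2)[of x] by linarith
      then show ?thesis using f(2)[of x] by (simp add: power2_eq_square)
    qed
    then show ?thesis
      by (intro Bochner_Integration.integrable_bound
            [OF Bochner_Integration.integrable_add[OF integrable_const[of "T\<^sup>2"] sq]]) auto
  qed
  \<comment> \<open>Sublevel sets of the exponential weights lie in compact sublevel sets of
    \<open>U\<close> and \<open>V\<close>, and \<open>W\<close> is bounded on their compact
    product.\<close>
  have W_bdd: "\<exists>w. \<forall>x y. exp (\<delta> * U x) \<le> r \<longrightarrow> exp (\<delta> * V y) \<le> r \<longrightarrow> W x y \<le> w" for r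
  proof -
    have "compact ({x. U x \<le> ln r / \<delta>} \<times> {y. V y \<le> ln r / \<delta>})"
      by (intro compact_Times compact_sublevel_U compact_sublevel_V)
    then obtain w where "\<And>z. z \<in> {x. U x \<le> ln r / \<delta>} \<times> {y. V y \<le> ln r / \<delta>} \<Longrightarrow> \<bar>case_prod W z\<bar> \<le> w"
      using locally_bounded_compact[OF locally_bounded_W] by metis
    then show ?thesis
      using sublevel_exp[OF \<delta>] by (intro exI[of _ w]) (fastforce simp: abs_le_iff)
  qed
  have "weighted_cost_pair (gibbs lam U) (gibbs nu V) W c
    (\<lambda>x. exp (\<delta> * U x)) (\<lambda>y. exp (\<delta> * V y))"
  proof
    show "integrable (gibbs lam U) (\<lambda>x. exp (LINT y|gibbs nu V. W x y))"
      by (rule bound[OF mu.prob_space_axioms sets(1) _ sqU P(1)]) auto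
    show "integrable (gibbs nu V) (\<lambda>y. exp (LINT x|gibbs lam U. W x y))"
      by (rule bound[OF eta.prob_space_axioms sets(2) _ sqV Q(1)]) auto
  qed (use sets c int_W sqU sqV P Q W_bdd in auto)
  then show ?thesis by (rule that)
qed

definition centered_U :: "nat \<Rightarrow> 'x \<Rightarrow> real" where
  "centered_U = potential (gibbs lam U) (gibbs nu V) W"

definition centered_V :: "nat \<Rightarrow> 'y \<Rightarrow> real" where
  "centered_V n = log_transform (gibbs lam U) W (centered_U n)"

text \<open>Moving \<open>exp (- U x)\<close> and \<open>exp (- V y)\<close> into the Gibbs measures
  turns the recursion into iterated log transforms. The pairs at times \<open>2 * n + 1\<close> and
  \<open>2 * Suc n\<close> share their second component.\<close>

lemma sinkhorn_eq:
  assumes A: "condition_A lam nu U V W \<delta>"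
  shows "sinkhorn lam nu U V W (2 * n + 1) = (\<lambda>x. U x + centered_U n x, \<lambda>y. V y + centered_V n y)"
    and "sinkhorn lam nu U V W (2 * Suc n) = (\<lambda>x. U x + centered_U (Suc n) x, \<lambda>y. V y + centered_V n y)"
    and "K_op nu W (\<lambda>y. exp (- (V y + centered_V n y))) x = exp (centered_U (Suc n) x)"
    and "K_flat lam W (\<lambda>x. exp (- (U x + centered_U n x))) y = exp (centered_V n y)"
proof -
  note [measurable_cong] = sets_lam sets_nu and [measurable] = measurable_U measurable_V measurable_W
  obtain c where "weighted_cost_pair (gibbs lam U) (gibbs nu V) W c
    (\<lambda>x. exp (\<delta> * U x)) (\<lambda>y. exp (\<delta> * V y))"
    using condition_A_weighted_cost_pair[OF A] .
  then interpret weighted_cost_pair "gibbs lam U" "gibbs nu V" W c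
    "\<lambda>x. exp (\<delta> * U x)" "\<lambda>y. exp (\<delta> * V y)" .
  interpret D: cost_pair "gibbs nu V" "gibbs lam U" "\<lambda>y x. W x y" c by (rule dual)
  have [measurable]: "centered_U n \<in> borel_measurable borel" "centered_V n \<in> borel_measurable borel" for n
    unfolding centered_V_def centered_U_def
    by (rule meas_u[OF admissible_potential], rule D.meas_u[OF admissible_copotential])
  show K: "K_op nu W (\<lambda>y. exp (- (V y + centered_V n y))) x = exp (centered_U (Suc n) x)" for n x
  proof -
    have "K_op nu W (\<lambda>y. exp (- (V y + centered_V n y))) x
        = (LINT y|nu. exp (- V y) *\<^sub>R (exp (- W x y) * exp (- centered_V n y)))"
      unfolding K_op_def
      by (intro Bochner_Integration.integral_cong) (simp_all flip: exp_add)
    also have "\<dots> = (LINT y|gibbs nu V. exp (- W x y) * exp (- centered_V n y))"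
      unfolding gibbs_def by (rule integral_density[symmetric]) auto
    also have "\<dots> = exp (centered_U (Suc n) x)"
      using D.exp_log_transform[OF admissible_copotential[of n], of x] by (simp add: centered_U_def centered_V_def)
    finally show ?thesis .
  qed
  show K': "K_flat lam W (\<lambda>x. exp (- (U x + centered_U n x))) y = exp (centered_V n y)" for n y
  proof -
    have "K_flat lam W (\<lambda>x. exp (- (U x + centered_U n x))) y
        = (LINT x|lam. exp (- U x) *\<^sub>R (exp (- W x y) * exp (- centered_U n x)))"
      unfolding K_flat_def
      by (intro Bochner_Integration.integral_cong) (simp_all flip: exp_add)
    also have "\<dots> = (LINT x|gibbs lam U. exp (- W x y) * exp (- centered_U n x))"
      unfolding gibbs_def by (rule integral_density[symmetric]) auto
    also have "\<dots> = exp (centered_V n y)"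
      using exp_log_transform[OF admissible_potential[of n], of y] by (simp add: centered_U_def centered_V_def)
    finally show ?thesis .
  qed
  \<comment> \<open>An odd step reads only the first component, so the induction can start at
    \<open>(U, \<lambda>_. 0)\<close> although its second component is not of the form
    \<open>V\<close> plus a centred potential.\<close>
  have odd: "sinkhorn lam nu U V W (2 * n + 1) = (\<lambda>x. U x + centered_U n x, \<lambda>y. V y + centered_V n y)"
    if "fst (sinkhorn lam nu U V W (2 * n)) = (\<lambda>x. U x + centered_U n x)" for n
    using that K'[of n] by (simp add: case_prod_beta)
  have even: "sinkhorn lam nu U V W (2 * Suc n) = (\<lambda>x. U x + centered_U (Suc n) x, \<lambda>y. V y + centered_V n y)"
    if "sinkhorn lam nu U V W (2 * n + 1) = (\<lambda>x. U x + centered_U n x, \<lambda>y. V y + centered_V n y)" for n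
  proof -
    have "sinkhorn lam nu U V W (Suc (2 * n + 1)) = (\<lambda>x. U x + centered_U (Suc n) x, \<lambda>y. V y + centered_V n y)"
      using that K[of n] by (simp only: sinkhorn.simps) simp
    then show ?thesis by simp
  qed
  show *: "sinkhorn lam nu U V W (2 * n + 1) = (\<lambda>x. U x + centered_U n x, \<lambda>y. V y + centered_V n y)" for n
  proof (induction n)
    case 0
    show ?case by (rule odd) (simp add: centered_U_def)
  next
    case (Suc n)
    show ?case by (rule odd) (simp only: even[OF Suc] fst_conv)
  qed
  show "sinkhorn lam nu U V W (2 * Suc n) = (\<lambda>x. U x + centered_U (Suc n) x, \<lambda>y. V y + centered_V n y)"
    by (rule even[OF *])
qed

text \<open>The normalising integrals are exponentials of the next potential, so each density
  becomes a single exponential. The even case starts at \<open>Suc n\<close> because the initial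
  second potential is 0.\<close>

lemma sinkhorn_transition_eq:
  assumes A: "condition_A lam nu U V W \<delta>"
  shows "K_even lam nu U V W (Suc n) x
      = density (gibbs nu V) (\<lambda>y. ennreal (exp (- W x y - centered_V n y - centered_U (Suc n) x)))"
    and "K_odd lam nu U V W n y
      = density (gibbs lam U) (\<lambda>x. ennreal (exp (- W x y - centered_U n x - centered_V n y)))"
proof -
  note [measurable_cong] = sets_lam sets_nu and [measurable] = measurable_U measurable_V measurable_W
  obtain c where "weighted_cost_pair (gibbs lam U) (gibbs nu V) W c
    (\<lambda>x. exp (\<delta> * U x)) (\<lambda>y. exp (\<delta> * V y))"
    using condition_A_weighted_cost_pair[OF A] .
  then interpret weighted_cost_pair "gibbs lam U" "gibbs nu V" W c
    "\<lambda>x. exp (\<delta> * U x)" "\<lambda>y. exp (\<delta> * V y)" .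
  interpret D: cost_pair "gibbs nu V" "gibbs lam U" "\<lambda>y x. W x y" c by (rule dual)
  have [measurable]: "centered_U n \<in> borel_measurable borel" "centered_V n \<in> borel_measurable borel" for n
    unfolding centered_V_def centered_U_def
    by (rule meas_u[OF admissible_potential], rule D.meas_u[OF admissible_copotential])
  note eq = sinkhorn_eq[OF A]
  show "K_even lam nu U V W (Suc n) x
      = density (gibbs nu V) (\<lambda>y. ennreal (exp (- W x y - centered_V n y - centered_U (Suc n) x)))"
    unfolding K_even_def Let_def sinkhorn_V_def eq(2) snd_conv eq(3) gibbs_def
    by (subst density_density_eq)
       (auto intro!: density_cong simp: algebra_simps simp flip: ennreal_mult exp_add exp_diff)
  show "K_odd lam nu U V W n y
      = density (gibbs lam U) (\<lambda>x. ennreal (exp (- W x y - centered_U n x - centered_V n y)))"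
    unfolding K_odd_def Let_def sinkhorn_U_def eq(1) fst_conv eq(4) gibbs_def
    by (subst density_density_eq)
       (auto intro!: density_cong simp: algebra_simps simp flip: ennreal_mult exp_add exp_diff)
qed

end

section \<open>Uniform contraction and moment bounds for the Sinkhorn transitions\<close>

theorem theorem5p23:
  fixes lam :: "'x::polish_space measure" and nu :: "'y::polish_space measure"
    and U :: "'x \<Rightarrow> real" and V :: "'y \<Rightarrow> real" and W :: "'x \<Rightarrow> 'y \<Rightarrow> real"
    and \<delta> :: real and g :: "'x \<Rightarrow> real" and h :: "'y \<Rightarrow> real"
  assumes setting: "schroedinger_setting lam nu U V W"
    and condA: "condition_A lam nu U V W \<delta>"
    and g_def: "g = (\<lambda>x. exp (\<delta> * U x))"
    and h_def: "h = (\<lambda>y. exp (\<delta> * V y))"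
  shows "(\<exists>a>0. \<exists>\<rho>. 0 < \<rho> \<and> \<rho> < 1 \<and>
            (\<forall>n\<ge>1. max
               (lip (\<lambda>x. 1/2 + a * g x) (\<lambda>y. 1/2 + a * h y) (K_even lam nu U V W n))
               (lip (\<lambda>y. 1/2 + a * h y) (\<lambda>x. 1/2 + a * g x) (K_odd lam nu U V W n))
             \<le> ennreal \<rho>))
    \<and> (SUP n\<in>{1..}. max (\<integral>\<^sup>+ y. ennreal (h y) \<partial>(pi_even lam nu U V W n))
                        (\<integral>\<^sup>+ x. ennreal (g x) \<partial>(pi_odd lam nu U V W n))) < \<infinity>
    \<and> (SUP n\<in>{1..}. max
          (weighted_sup_norm g (kernel_int (K_even lam nu U V W n) h))
          (weighted_sup_norm h (kernel_int (K_odd lam nu U V W n) g))) < \<infinity>"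
proof -
  interpret schroedinger_setting lam nu U V W by (rule setting)
  define mu where "mu = gibbs lam U"
  define eta where "eta = gibbs nu V"
  obtain c where "weighted_cost_pair mu eta W c g h"
    using condition_A_weighted_cost_pair[OF condA] unfolding mu_def eta_def g_def h_def .
  then interpret weighted_cost_pair mu eta W c g h .
  interpret D: weighted_cost_pair eta mu "\<lambda>y x. W x y" c h g by (rule weighted_dual)
  \<comment> \<open>\<open>k n\<close> and \<open>k' n\<close> are the densities of the transitions
    with index \<open>2 * Suc n\<close> and \<open>2 * Suc n + 1\<close>; the shift matches the
    range \<open>n \<ge> 1\<close>.\<close>
  define k where "k n x y = exp (- W x y - copot n y - pot (Suc n) x)" for n x y
  define k' where "k' n y x = exp (- W x y - pot (Suc n) x - copot (Suc n) y)" for n x y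
  obtain D where D: "0 < D"
    and D_even: "\<And>n. gibbs_kernel D (\<lambda>x y. exp (- W x y - copot n y - pot (Suc n) x))"
    and D_odd: "\<And>n. D.gibbs_kernel D (\<lambda>y x. exp (- W x y - pot (Suc n) x - copot (Suc n) y))"
    by (rule gibbs_kernel_potentials) blast
  have k: "gibbs_kernel D (k n)" and k': "D.gibbs_kernel D (k' n)" for n
    unfolding k_def[abs_def] k'_def[abs_def] by (rule D_even D_odd)+
  have even: "K_even lam nu U V W (Suc n) = kernel_measure (k n)"
    and odd: "K_odd lam nu U V W (Suc n) = D.kernel_measure (k' n)" for n
    unfolding kernel_measure_def[abs_def] D.kernel_measure_def[abs_def]
    by (auto simp: fun_eq_iff sinkhorn_transition_eq[OF condA] k_def k'_def
        centered_U_def centered_V_def mu_def eta_def simp del: potential.simps)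
  have ge1: "(\<forall>n\<ge>1. R n) \<longleftrightarrow> (\<forall>n. R (Suc n))" for R
    by (metis One_nat_def Suc_le_D Suc_le_mono le0)
  obtain C1 where C1: "\<And>n x. (\<integral>\<^sup>+ y. ennreal (h y) \<partial>kernel_measure (k n) x) \<le> ennreal (g x / 4 + C1)"
    by (rule kernel_measure_drift[OF D]) (use k in blast)
  obtain C2 where C2: "\<And>n y. (\<integral>\<^sup>+ x. ennreal (g x) \<partial>D.kernel_measure (k' n) y) \<le> ennreal (h y / 4 + C2)"
    by (rule D.kernel_measure_drift[OF D]) (use k' in blast)
  \<comment> \<open>One positive drift constant for both directions, since both contractions must
    use the same \<open>a\<close>.\<close>
  define C where "C = max 1 (max C1 C2)"
  obtain \<kappa>1 m1 where m1: "0 < \<kappa>1" "sets m1 = sets borel" "ennreal \<kappa>1 \<le> emeasure m1 UNIV"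
    "\<And>n x. g x \<le> 8 * C \<Longrightarrow> m1 \<le> kernel_measure (k n) x"
    by (rule kernel_measure_minorization[OF D, of "8 * C"]) (use k in blast)
  obtain \<kappa>2 m2 where m2: "0 < \<kappa>2" "sets m2 = sets borel" "ennreal \<kappa>2 \<le> emeasure m2 UNIV"
    "\<And>n y. h y \<le> 8 * C \<Longrightarrow> m2 \<le> D.kernel_measure (k' n) y"
    by (rule D.kernel_measure_minorization[OF D, of "8 * C"]) (use k' in blast)
  \<comment> \<open>Both minorizing masses are replaced by a common \<open>\<kappa> \<le> 1\<close>;
    then \<open>a\<close> is forced by \<open>a * C = \<kappa> / 8\<close>.\<close>
  define \<kappa> where "\<kappa> = min 1 (min \<kappa>1 \<kappa>2)"
  define a where "a = \<kappa> / (8 * C)"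
  have C: "0 < C" "C1 \<le> C" "C2 \<le> C" by (auto simp: C_def)
  have \<kappa>: "0 < \<kappa>" "\<kappa> \<le> 1" "\<kappa> \<le> \<kappa>1" "\<kappa> \<le> \<kappa>2" using m1(1) m2(1) by (auto simp: \<kappa>_def)
  have a: "0 < a" "a * C = \<kappa> / 8" using C \<kappa> by (auto simp: a_def)
  have lip_even: "drift_minorization (kernel_measure (k n)) g h C \<kappa> a m1" for n
  proof
    show "(\<integral>\<^sup>+ y. ennreal (h y) \<partial>kernel_measure (k n) x) \<le> ennreal (g x / 4 + C)" for x
      using C by (intro order_trans[OF C1] ennreal_leI) auto
    show "ennreal \<kappa> \<le> emeasure m1 UNIV"
      using \<kappa> by (intro order_trans[OF ennreal_leI m1(3)])
  qed (use measurable_kernel_measure[OF k] g_pos h_pos m1 a \<kappa> in \<open>auto simp: less_imp_le\<close>)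
  have lip_odd: "drift_minorization (D.kernel_measure (k' n)) h g C \<kappa> a m2" for n
  proof
    show "(\<integral>\<^sup>+ x. ennreal (g x) \<partial>D.kernel_measure (k' n) y) \<le> ennreal (h y / 4 + C)" for y
      using C by (intro order_trans[OF C2] ennreal_leI) auto
    show "ennreal \<kappa> \<le> emeasure m2 UNIV"
      using \<kappa> by (intro order_trans[OF ennreal_leI m2(3)])
  qed (use D.measurable_kernel_measure[OF k'] g_pos h_pos m2 a \<kappa> in \<open>auto simp: less_imp_le\<close>)
  have contraction: "\<exists>a>0. \<exists>\<rho>. 0 < \<rho> \<and> \<rho> < 1 \<and>
            (\<forall>n\<ge>1. max
               (lip (\<lambda>x. 1/2 + a * g x) (\<lambda>y. 1/2 + a * h y) (K_even lam nu U V W n))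
               (lip (\<lambda>y. 1/2 + a * h y) (\<lambda>x. 1/2 + a * g x) (K_odd lam nu U V W n))
             \<le> ennreal \<rho>)"
    unfolding ge1 even odd
    using \<kappa> a lip_even[THEN drift_minorization.lip_le] lip_odd[THEN drift_minorization.lip_le]
    by (intro exI[of _ a] exI[of _ "1 - \<kappa> / 4"] conjI allI max.boundedI) auto
  obtain T1 where T1: "0 \<le> T1"
    "\<And>n x. (\<integral>\<^sup>+ y. ennreal (h y) \<partial>kernel_measure (k n) x) \<le> ennreal (T1 * g x)"
    by (rule kernel_measure_h_le_g[OF D]) (use k in blast)
  obtain T2 where T2: "0 \<le> T2"
    "\<And>n y. (\<integral>\<^sup>+ x. ennreal (g x) \<partial>D.kernel_measure (k' n) y) \<le> ennreal (T2 * h y)"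
    by (rule D.kernel_measure_h_le_g[OF D]) (use k' in blast)
  \<comment> \<open>The kernel bound by \<open>T1 * g x\<close> is integrated against
    \<open>mu\<close>, under which \<open>g\<close> is integrable.\<close>
  have pi_even_le: "(\<integral>\<^sup>+ y. ennreal (h y) \<partial>pi_even lam nu U V W (Suc n)) \<le> ennreal (LINT x|mu. T1 * g x)" for n
  proof -
    have "kernel_measure (k n) \<in> mu \<rightarrow>\<^sub>M subprob_algebra borel"
      using measurable_prob_algebraD[OF measurable_kernel_measure[OF k]]
      by (simp add: measurable_cong_sets[OF sets_mu refl])
    then have "(\<integral>\<^sup>+ y. ennreal (h y) \<partial>pi_even lam nu U V W (Suc n))
        = (\<integral>\<^sup>+ x. \<integral>\<^sup>+ y. ennreal (h y) \<partial>kernel_measure (k n) x \<partial>mu)"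
      unfolding pi_even_def even mu_def[symmetric] by (intro nn_integral_bind) auto
    also have "\<dots> \<le> (\<integral>\<^sup>+ x. ennreal (T1 * g x) \<partial>mu)"
      by (intro nn_integral_mono T1)
    also have "\<dots> = ennreal (LINT x|mu. T1 * g x)"
      using T1(1) g_pos by (intro nn_integral_eq_integral integrable_mult_right integrable_g) (auto simp: less_imp_le)
    finally show ?thesis .
  qed
  have pi_odd_le: "(\<integral>\<^sup>+ x. ennreal (g x) \<partial>pi_odd lam nu U V W (Suc n)) \<le> ennreal (LINT y|eta. T2 * h y)" for n
  proof -
    have "D.kernel_measure (k' n) \<in> eta \<rightarrow>\<^sub>M subprob_algebra borel"
      using measurable_prob_algebraD[OF D.measurable_kernel_measure[OF k']]
      by (simp add: measurable_cong_sets[OF sets_eta refl])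
    then have "(\<integral>\<^sup>+ x. ennreal (g x) \<partial>pi_odd lam nu U V W (Suc n))
        = (\<integral>\<^sup>+ y. \<integral>\<^sup>+ x. ennreal (g x) \<partial>D.kernel_measure (k' n) y \<partial>eta)"
      unfolding pi_odd_def odd eta_def[symmetric] by (intro nn_integral_bind) auto
    also have "\<dots> \<le> (\<integral>\<^sup>+ y. ennreal (T2 * h y) \<partial>eta)"
      by (intro nn_integral_mono T2)
    also have "\<dots> = ennreal (LINT y|eta. T2 * h y)"
      using T2(1) h_pos by (intro nn_integral_eq_integral integrable_mult_right D.integrable_g) (auto simp: less_imp_le)
    finally show ?thesis .
  qed
  have "(SUP n\<in>{1..}. max (\<integral>\<^sup>+ y. ennreal (h y) \<partial>(pi_even lam nu U V W n))
        (\<integral>\<^sup>+ x. ennreal (g x) \<partial>(pi_odd lam nu U V W n)))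
      \<le> max (ennreal (LINT x|mu. T1 * g x)) (ennreal (LINT y|eta. T2 * h y))"
    unfolding SUP_le_iff atLeast_iff Ball_def ge1 by (intro allI max.mono pi_even_le pi_odd_le)
  moreover have "(SUP n\<in>{1..}. max (weighted_sup_norm g (kernel_int (K_even lam nu U V W n) h))
          (weighted_sup_norm h (kernel_int (K_odd lam nu U V W n) g))) \<le> max (ennreal T1) (ennreal T2)"
  proof -
    have "weighted_sup_norm g (kernel_int (K_even lam nu U V W (Suc n)) h) \<le> ennreal T1" for n
      unfolding weighted_sup_norm_def kernel_int_def even
      using T1 g_pos by (intro SUP_least divide_le_posI_ennreal) (auto simp: ennreal_mult[symmetric] less_imp_le mult.commute)
    moreover have "weighted_sup_norm h (kernel_int (K_odd lam nu U V W (Suc n)) g) \<le> ennreal T2" for n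
      unfolding weighted_sup_norm_def kernel_int_def odd
      using T2 h_pos by (intro SUP_least divide_le_posI_ennreal) (auto simp: ennreal_mult[symmetric] less_imp_le mult.commute)
    ultimately show ?thesis
      unfolding SUP_le_iff atLeast_iff Ball_def ge1 by (intro allI max.mono)
  qed
  ultimately show ?thesis
    using contraction by (auto elim!: le_less_trans)
qed

end
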